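(* Let $f\in\mathbb{C}[x_0,\ldots,x_{d-1}]$ be a homogeneous cubic polynomial, $d\ge 2$, such that $\mathrm{Hess}(f)$ is the power of a nonzero linear form. Then $f$ is homaloidal. In particular, any persistent cubic polynomial is homaloidal.
   Context: The Hessian is $\mathrm{Hess}(f)=\det\left(\frac{\partial^2 f}{\partial x_i\partial x_j}\right)_{0\le i,j\le d-1}$. A homogeneous polynomial $f$ is homaloidal if its polar map $\nabla f\colon\mathbb{P}^{d-1}\dashrightarrow(\mathbb{P}^{d-1})^\vee$, $[x_0:\cdots:x_{d-1}]\mapsto\left[\frac{\partial f}{\partial x_0}:\cdots:\frac{\partial f}{\partial x_{d-1}}\right]$, is a birational map. A homogeneous polynomial $f$ is concise if its partial derivatives $\partial f/\partial x_0,\ldots,\partial f/\partial x_{d-1}$ are linearly independent. For $u\in(\mathbb{C}^d)^\vee$ with coordinates $(u_0,\ldots,u_{d-1})$ write $\frac{\partial f}{\partial u}=\sum_i u_i\frac{\partial f}{\partial x_i}$. A quadratic form on $\mathbb{C}^d$ is persistent if it has maximal rank. A cubic form $f\in\mathrm{Sym}^3V$, $V=\mathbb{C}^d$, is persistent if it is concise and there exists a hyperplane (linear subspace of codimension one) $S\subsetneq V^\vee$ such that the quadratic form $\frac{\partial f}{\partial u}\in\mathrm{Sym}^2V$ has maximal rank for every $u\notin S$. *)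

theory Defs
  imports
    "HOL-Library.Poly_Mapping"
    "HOL.Complex"
    "Jordan_Normal_Form.Determinant"
    "Jordan_Normal_Form.DL_Rank"
begin

text \<open>Complex polynomials in variables indexed by the natural numbers: a monomial is its exponent
  vector. The ring of polynomials in the first \<open>d\<close> variables is cut out by \<open>polys d\<close>.\<close>

type_synonym monomial = "nat \<Rightarrow>\<^sub>0 nat"
type_synonym cpoly = "monomial \<Rightarrow>\<^sub>0 complex"

definition Const :: "complex \<Rightarrow> cpoly" where
  "Const c = Poly_Mapping.single 0 c"

definition Var :: "nat \<Rightarrow> cpoly" where
  "Var i = Poly_Mapping.single (Poly_Mapping.single i 1) 1"

definition polys :: "nat \<Rightarrow> cpoly set" where
  "polys d = {p. \<forall>m \<in> Poly_Mapping.keys p. Poly_Mapping.keys m \<subseteq> {..<d}}"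

definition mdeg :: "monomial \<Rightarrow> nat" where
  "mdeg m = (\<Sum>i \<in> Poly_Mapping.keys m. Poly_Mapping.lookup m i)"

text \<open>The zero polynomial is a form of every degree.\<close>

definition forms :: "nat \<Rightarrow> nat \<Rightarrow> cpoly set" where
  "forms d n = {p \<in> polys d. \<forall>m \<in> Poly_Mapping.keys p. mdeg m = n}"

text \<open>Subtraction of exponent vectors is truncated, but where it truncates the coefficient is zero.\<close>

definition pdiff :: "nat \<Rightarrow> cpoly \<Rightarrow> cpoly" where
  "pdiff i p = (\<Sum>m \<in> Poly_Mapping.keys p.
     Poly_Mapping.single (m - Poly_Mapping.single i 1)
       (of_nat (Poly_Mapping.lookup m i) * Poly_Mapping.lookup p m))"

definition subst :: "(nat \<Rightarrow> cpoly) \<Rightarrow> cpoly \<Rightarrow> cpoly" where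
  "subst g p = (\<Sum>m \<in> Poly_Mapping.keys p.
     Const (Poly_Mapping.lookup p m) *
       (\<Prod>i \<in> Poly_Mapping.keys m. g i ^ Poly_Mapping.lookup m i))"

definition Hess :: "nat \<Rightarrow> cpoly \<Rightarrow> cpoly" where
  "Hess d f = det (mat d d (\<lambda>(i, j). pdiff i (pdiff j f)))"

text \<open>A rational map from projective \<open>(d - 1)\<close>-space to itself is given by a tuple of \<open>d\<close> forms
  of the same degree, not all zero; two tuples give the same map iff they are proportional over the
  function field. Dual projective space is identified with projective space through the dual
  coordinates. Only the entries with index below \<open>d\<close> matter.\<close>

definition rational_map :: "nat \<Rightarrow> (nat \<Rightarrow> cpoly) \<Rightarrow> bool" where
  "rational_map d F \<longleftrightarrow> (\<exists>e. \<forall>i<d. F i \<in> forms d e) \<and> (\<exists>i<d. F i \<noteq> 0)"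

definition same_rational_map :: "nat \<Rightarrow> (nat \<Rightarrow> cpoly) \<Rightarrow> (nat \<Rightarrow> cpoly) \<Rightarrow> bool" where
  "same_rational_map d F G \<longleftrightarrow> (\<forall>i<d. \<forall>j<d. F i * G j = F j * G i)"

definition rat_comp :: "(nat \<Rightarrow> cpoly) \<Rightarrow> (nat \<Rightarrow> cpoly) \<Rightarrow> nat \<Rightarrow> cpoly" where
  "rat_comp G F = (\<lambda>i. subst F (G i))"

text \<open>The composite of two rational maps exists iff the substituted tuple is not identically zero,
  hence the conditions \<open>rational_map d (rat_comp _ _)\<close>.\<close>

definition birational_map :: "nat \<Rightarrow> (nat \<Rightarrow> cpoly) \<Rightarrow> bool" where
  "birational_map d F \<longleftrightarrow> rational_map d F \<and>
     (\<exists>G. rational_map d G \<and>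
        rational_map d (rat_comp G F) \<and> same_rational_map d (rat_comp G F) Var \<and>
        rational_map d (rat_comp F G) \<and> same_rational_map d (rat_comp F G) Var)"

definition homaloidal :: "nat \<Rightarrow> cpoly \<Rightarrow> bool" where
  "homaloidal d f \<longleftrightarrow> birational_map d (\<lambda>i. pdiff i f)"

definition dir_deriv :: "nat \<Rightarrow> complex vec \<Rightarrow> cpoly \<Rightarrow> cpoly" where
  "dir_deriv d u f = (\<Sum>i<d. Const (u $ i) * pdiff i f)"

text \<open>Linear independence of the family of partial derivatives (not of the set of its values).\<close>

definition concise :: "nat \<Rightarrow> cpoly \<Rightarrow> bool" where
  "concise d f \<longleftrightarrow>
     (\<forall>c. (\<Sum>i<d. Const (c i) * pdiff i f) = 0 \<longrightarrow> (\<forall>i<d. c i = 0))"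

text \<open>The symmetric matrix \<open>A\<close> with \<open>q = (\<Sum>i j. A i j * x i * x j)\<close>: a mixed coefficient of \<open>q\<close>
  is shared between two entries.\<close>

definition gram_mat :: "nat \<Rightarrow> cpoly \<Rightarrow> complex mat" where
  "gram_mat d q = mat d d (\<lambda>(i, j).
     Poly_Mapping.lookup q (Poly_Mapping.single i 1 + Poly_Mapping.single j 1) /
       (if i = j then 1 else 2))"

definition maximal_rank :: "nat \<Rightarrow> cpoly \<Rightarrow> bool" where
  "maximal_rank d q \<longleftrightarrow> q \<in> forms d 2 \<and> vec_space.rank d (gram_mat d q) = d"

definition hyperplane :: "nat \<Rightarrow> complex vec set \<Rightarrow> bool" where
  "hyperplane d S \<longleftrightarrow>
     subspace class_ring S (module_vec TYPE(complex) d) \<and>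
     vectorspace.dim class_ring (module_vec TYPE(complex) d \<lparr>carrier := S\<rparr>) + 1 = d"

definition persistent_cubic :: "nat \<Rightarrow> cpoly \<Rightarrow> bool" where
  "persistent_cubic d f \<longleftrightarrow> f \<in> forms d 3 \<and> concise d f \<and>
     (\<exists>S. hyperplane d S \<and>
        (\<forall>u \<in> carrier_vec d - S. maximal_rank d (dir_deriv d u f)))"

end

theory Submission
  imports Defs "HOL-Computational_Algebra.Fundamental_Theorem_Algebra"
begin

text \<open>
  Write \<open>F\<close> for the polar map of the cubic \<open>f\<close> and \<open>H\<close> for its matrix of second derivatives. The
  entries of \<open>H\<close> are linear forms and the components of \<open>F\<close> are quadratic, so polarization gives
  \<open>2 (F(a) - F(b)) = H(a + b) (a - b)\<close> for all \<open>a\<close> and \<open>b\<close> (\<open>polar_difference\<close>). Suppose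
  \<open>det H = l ^ k\<close> with \<open>l\<close> linear, and let \<open>F(a) = F(b)\<close> with \<open>l(a) \<noteq> 0\<close>. Since
  \<open>l(a + b) + l(a - b) = 2 l(a)\<close>, one of \<open>H(a + b)\<close> and \<open>H(a - b)\<close> is invertible, and as \<open>F\<close> is
  even, \<open>b = a\<close> or \<open>b = - a\<close>. So the general fibre of \<open>F\<close> is \<open>{a, - a}\<close>, a single projective point.

  To pass from this to an inverse rational map, let \<open>L\<close> be the field of fractions of the polynomial
  ring and \<open>K\<close> the subfield of the rational expressions in the components of \<open>F\<close>. In \<open>L \<otimes>\<^sub>K L\<close> the
  points \<open>a = x \<otimes> 1\<close> and \<open>b = 1 \<otimes> x\<close> have the same image under \<open>F\<close>. The computation above,
  with determinants in place of inverse matrices (\<open>polar_fibre\<close>), shows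
  \<open>x\<^sub>i x\<^sub>j \<otimes> 1 = 1 \<otimes> x\<^sub>i x\<^sub>j\<close>, which forces \<open>x\<^sub>i x\<^sub>j \<in> K\<close>. The tensor product
  is handled through its pairing with a \<open>K\<close>-linear map \<open>L \<Rightarrow> L\<close> that kills \<open>1\<close> but not
  \<open>x\<^sub>i x\<^sub>j\<close> (\<open>subfield_separating_functional\<close>, \<open>coordinate_products_in_subfield\<close>).

  Clearing denominators and taking homogeneous components gives forms \<open>G\<^sub>i\<close> of equal degree with
  \<open>G\<^sub>i(F(x)) = q(x) x\<^sub>0 x\<^sub>i\<close> (\<open>polar_left_inverse\<close>), so \<open>G\<close> is a left inverse of \<open>F\<close>. Then
  \<open>F(G(y))\<close> is proportional to \<open>y\<close> at \<open>y = F(x)\<close>, and hence identically, because the components of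
  \<open>F\<close> satisfy no homogeneous algebraic relation (\<open>jacobian_criterion\<close>).

  If \<open>f\<close> is persistent with hyperplane \<open>S\<close>, then \<open>Hess d f\<close> has no zero outside \<open>S\<close>. For \<open>e \<notin> S\<close> and
  \<open>s \<in> S\<close> the line of the points \<open>e + t s\<close> avoids \<open>S\<close>, so the Hessian is constant on it by the
  fundamental theorem of algebra. It is therefore a multiple of the \<open>d\<close>-th power of the equation of
  \<open>S\<close>, and the constant is absorbed by a \<open>d\<close>-th root (\<open>persistent_Hess_power\<close>).
\<close>

section \<open>Evaluation homomorphisms\<close>

text \<open>The coefficients are mapped by \<open>h\<close> and the variables by \<open>g\<close>. With \<open>h = Const\<close> this is
  substitution. Other targets below are \<open>complex\<close> (values at a point), \<open>complex poly\<close>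
  (restriction to a line) and a polynomial ring over the field of fractions.\<close>

definition eval_hom :: "(complex \<Rightarrow> 'a::comm_ring_1) \<Rightarrow> (nat \<Rightarrow> 'a) \<Rightarrow> cpoly \<Rightarrow> 'a" where
  "eval_hom h g p = (\<Sum>m \<in> Poly_Mapping.keys p.
     h (Poly_Mapping.lookup p m) *
       (\<Prod>i \<in> Poly_Mapping.keys m. g i ^ Poly_Mapping.lookup m i))"

lemma subst_eq_eval_hom: "subst g = eval_hom Const g"
  by (simp add: fun_eq_iff subst_def eval_hom_def)

lemma Const_hom: "comm_ring_hom Const"
  by unfold_locales (simp_all add: Const_def single_add mult_single)

lemma Const_0 [simp]: "Const 0 = 0" and Const_1 [simp]: "Const 1 = 1"
  by (simp_all add: Const_def)

lemma Const_add: "Const (a + b) = Const a + Const b"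
  and Const_mult: "Const (a * b) = Const a * Const b"
  by (simp_all add: Const_def single_add mult_single)

lemma Const_of_nat: "Const (of_nat n) = of_nat n"
  by (simp add: Const_def)

definition monom_eval :: "(nat \<Rightarrow> 'a::comm_ring_1) \<Rightarrow> monomial \<Rightarrow> 'a" where
  "monom_eval g m = (\<Prod>i \<in> Poly_Mapping.keys m. g i ^ Poly_Mapping.lookup m i)"

lemma monom_eval_superset:
  assumes "finite A" "Poly_Mapping.keys m \<subseteq> A"
  shows "monom_eval g m = (\<Prod>i \<in> A. g i ^ Poly_Mapping.lookup m i)"
  unfolding monom_eval_def using assms
  by (intro prod.mono_neutral_left) (auto simp: in_keys_iff)

lemma monom_eval_add: "monom_eval g (m + n) = monom_eval g m * monom_eval g n"
proof -
  let ?A = "Poly_Mapping.keys m \<union> Poly_Mapping.keys n"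
  have "finite ?A" by simp
  then show ?thesis
    using monom_eval_superset[of ?A "m + n" g] monom_eval_superset[of ?A m g]
      monom_eval_superset[of ?A n g] Poly_Mapping.keys_add[of m n]
    by (simp add: lookup_add power_add prod.distrib)
qed

lemma monom_eval_0 [simp]: "monom_eval g 0 = 1"
  by (simp add: monom_eval_def)

lemma eval_hom_superset:
  assumes "comm_ring_hom h" "finite A" "Poly_Mapping.keys p \<subseteq> A"
  shows "eval_hom h g p = (\<Sum>m \<in> A. h (Poly_Mapping.lookup p m) * monom_eval g m)"
proof -
  interpret comm_ring_hom h by fact
  show ?thesis
    unfolding eval_hom_def monom_eval_def using assms
    by (intro sum.mono_neutral_left) (auto simp: in_keys_iff)
qed

lemma eval_hom_add:
  assumes "comm_ring_hom h"
  shows "eval_hom h g (p + q) = eval_hom h g p + eval_hom h g q"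
proof -
  interpret comm_ring_hom h by fact
  let ?A = "Poly_Mapping.keys p \<union> Poly_Mapping.keys q"
  have "finite ?A" by simp
  then show ?thesis
    using eval_hom_superset[OF assms, of ?A "p + q" g] eval_hom_superset[OF assms, of ?A p g]
      eval_hom_superset[OF assms, of ?A q g] Poly_Mapping.keys_add[of p q]
    by (simp add: lookup_add hom_add sum.distrib distrib_right)
qed

lemma eval_hom_single:
  assumes "comm_ring_hom h"
  shows "eval_hom h g (Poly_Mapping.single m c) = h c * monom_eval g m"
proof -
  interpret comm_ring_hom h by fact
  show ?thesis using eval_hom_superset[OF assms, of "{m}" "Poly_Mapping.single m c" g] by auto
qed

lemma poly_mapping_eq_sum_single:
  fixes p :: "'a \<Rightarrow>\<^sub>0 'b::comm_monoid_add"
  shows "p = (\<Sum>m \<in> Poly_Mapping.keys p. Poly_Mapping.single m (Poly_Mapping.lookup p m))"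
  by (rule poly_mapping_eqI)
    (auto simp: lookup_sum lookup_single when_def in_keys_iff)

lemma poly_mapping_term_induct [case_names zero add single]:
  fixes p :: "'a \<Rightarrow>\<^sub>0 'b::comm_monoid_add"
  assumes "P 0" and "\<And>p q. P p \<Longrightarrow> P q \<Longrightarrow> P (p + q)"
    and "\<And>m c. P (Poly_Mapping.single m c)"
  shows "P p"
proof -
  have "P (\<Sum>m \<in> A. Poly_Mapping.single m (Poly_Mapping.lookup p m))" if "finite A" for A
    using that by induction (use assms in auto)
  from this[of "Poly_Mapping.keys p"] show ?thesis
    using poly_mapping_eq_sum_single[of p] by simp
qed

lemma eval_hom_0 [simp]: "eval_hom h g 0 = 0"
  by (simp add: eval_hom_def)

lemma eval_hom_mult:
  assumes "comm_ring_hom h"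
  shows "eval_hom h g (p * q) = eval_hom h g p * eval_hom h g q"
proof (induction p rule: poly_mapping_term_induct)
  case (single m c)
  interpret comm_ring_hom h by fact
  show ?case
  proof (induction q rule: poly_mapping_term_induct)
    case (single n b)
    show ?case
      by (simp add: mult_single eval_hom_single[OF assms] monom_eval_add hom_mult mult_ac)
  qed (simp_all add: eval_hom_add[OF assms] distrib_left)
qed (simp_all add: eval_hom_add[OF assms] distrib_right)

lemma eval_hom_Const: "comm_ring_hom h \<Longrightarrow> eval_hom h g (Const c) = h c"
  by (simp add: Const_def eval_hom_single)

lemma eval_hom_Var: "comm_ring_hom h \<Longrightarrow> eval_hom h g (Var i) = g i"
  by (simp add: Var_def eval_hom_single monom_eval_def comm_ring_hom.axioms
      comm_semiring_hom.axioms semiring_hom.axioms monoid_mult_hom.axioms one_hom.hom_one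
      ring_hom.axioms)

lemma eval_hom_hom:
  assumes "comm_ring_hom h"
  shows "comm_ring_hom (eval_hom h g)"
proof -
  interpret comm_ring_hom h by fact
  show ?thesis
    using eval_hom_Const[OF assms, of g 1]
    by unfold_locales (simp_all add: eval_hom_add eval_hom_mult assms)
qed

lemma subst_hom: "comm_ring_hom (subst g)"
  unfolding subst_eq_eval_hom by (intro eval_hom_hom Const_hom)

lemma Var_power: "Var i ^ n = Poly_Mapping.single (Poly_Mapping.single i n) 1"
  by (induction n) (simp_all add: Var_def mult_single flip: single_add)

lemma single_eq_monom_eval: "Poly_Mapping.single m 1 = monom_eval Var m"
proof -
  have "(\<Prod>i \<in> A. Poly_Mapping.single (s i) (1::complex)) = Poly_Mapping.single (\<Sum>i\<in>A. s i) 1"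
    if "finite A" for A and s :: "nat \<Rightarrow> monomial"
    using that by induction (simp_all add: mult_single)
  then show ?thesis
    using poly_mapping_eq_sum_single[of m] by (simp add: monom_eval_def Var_power)
qed

lemma subst_Var [simp]: "subst Var p = p"
proof (induction p rule: poly_mapping_term_induct)
  case (single m c)
  show ?case
    by (simp add: subst_eq_eval_hom eval_hom_single[OF Const_hom] mult_single
        flip: single_eq_monom_eval) (simp add: Const_def mult_single)
qed (simp_all add: subst_eq_eval_hom eval_hom_add Const_hom)

lemma polys_induct [consumes 1, case_names Const Var add mult]:
  assumes p: "p \<in> polys d"
    and C: "\<And>c. P (Const c)" and V: "\<And>i. i < d \<Longrightarrow> P (Var i)"
    and add: "\<And>p q. P p \<Longrightarrow> P q \<Longrightarrow> P (p + q)"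
    and mult: "\<And>p q. P p \<Longrightarrow> P q \<Longrightarrow> P (p * q)"
  shows "P p"
proof -
  have sum: "P (\<Sum>x\<in>A. s x)" if "finite A" "\<And>x. x \<in> A \<Longrightarrow> P (s x)" for A and s :: "monomial \<Rightarrow> cpoly"
    using that by induction (use C[of 0] add in auto)
  have prod: "P (\<Prod>x\<in>A. s x)" if "finite A" "\<And>x. x \<in> A \<Longrightarrow> P (s x)" for A and s :: "nat \<Rightarrow> cpoly"
    using that by induction (use C[of 1] mult in auto)
  have pow: "P (q ^ n)" if "P q" for q n
    using that by (induction n) (use C[of 1] mult in auto)
  have "P (subst Var p)"
    unfolding subst_def
    by (intro sum mult C prod pow V) (use p in \<open>auto simp: polys_def\<close>)
  then show ?thesis by simp
qed

lemma ex_polys: "\<exists>d. p \<in> polys d"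
proof -
  have "finite (\<Union>m \<in> Poly_Mapping.keys p. Poly_Mapping.keys m)" by simp
  then obtain d where "(\<Union>m \<in> Poly_Mapping.keys p. Poly_Mapping.keys m) \<subseteq> {..<d}"
    using finite_nat_iff_bounded by blast
  then show ?thesis by (auto simp: polys_def)
qed

lemma cpoly_induct [case_names Const Var add mult]:
  assumes "\<And>c. P (Const c)" and "\<And>i. P (Var i)"
    and "\<And>p q. P p \<Longrightarrow> P q \<Longrightarrow> P (p + q)"
    and "\<And>p q. P p \<Longrightarrow> P q \<Longrightarrow> P (p * q)"
  shows "P p"
proof -
  obtain d where "p \<in> polys d" using ex_polys by blast
  then show ?thesis using assms by (induction p rule: polys_induct) auto
qed

lemma subst_subst: "subst g (subst k p) = subst (\<lambda>i. subst g (k i)) p"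
proof -
  show ?thesis
    by (induction p rule: cpoly_induct)
      (simp_all add: subst_eq_eval_hom eval_hom_Const eval_hom_Var eval_hom_add eval_hom_mult Const_hom)
qed

lemma subst_Const [simp]: "subst g (Const c) = Const c"
  and subst_add: "subst g (p + q) = subst g p + subst g q"
  and subst_mult: "subst g (p * q) = subst g p * subst g q"
  and subst_Var_apply [simp]: "subst g (Var i) = g i"
  by (simp_all add: subst_eq_eval_hom eval_hom_Const eval_hom_Var eval_hom_add eval_hom_mult Const_hom)

lemma subst_cong:
  assumes "p \<in> polys d" "\<And>i. i < d \<Longrightarrow> g i = k i"
  shows "subst g p = subst k p"
  using assms(1)
  by (induction p rule: polys_induct) (simp_all add: assms subst_add subst_mult)

section \<open>Forms\<close>

lemma mdeg_superset:
  assumes "finite A" "Poly_Mapping.keys m \<subseteq> A"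
  shows "mdeg m = (\<Sum>i \<in> A. Poly_Mapping.lookup m i)"
  unfolding mdeg_def using assms
  by (intro sum.mono_neutral_left) (auto simp: in_keys_iff)

lemma mdeg_add: "mdeg (m + n) = mdeg m + mdeg n"
proof -
  let ?A = "Poly_Mapping.keys m \<union> Poly_Mapping.keys n"
  have "finite ?A" by simp
  then show ?thesis
    using mdeg_superset[of ?A "m + n"] mdeg_superset[of ?A m]
      mdeg_superset[of ?A n] Poly_Mapping.keys_add[of m n]
    by (simp add: lookup_add sum.distrib)
qed

lemma mdeg_eq_0_iff: "mdeg m = 0 \<longleftrightarrow> m = 0"
proof
  assume "mdeg m = 0"
  then have "\<forall>i\<in>Poly_Mapping.keys m. Poly_Mapping.lookup m i = 0"
    by (simp add: mdeg_def)
  then show "m = 0"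
    by (intro poly_mapping_eqI) (metis in_keys_iff lookup_zero)
qed (simp add: mdeg_def)

lemma mdeg_single [simp]: "mdeg (Poly_Mapping.single i n) = n"
  by (cases "n = 0") (auto simp: mdeg_def)

lemma polysI:
  "(\<And>m. m \<in> Poly_Mapping.keys p \<Longrightarrow> Poly_Mapping.keys m \<subseteq> {..<d}) \<Longrightarrow> p \<in> polys d"
  by (auto simp: polys_def)

lemma zero_polys [simp, intro]: "0 \<in> polys d"
  by (simp add: polys_def)

lemma Const_polys [simp, intro]: "Const c \<in> polys d"
  by (auto simp: polys_def Const_def split: if_splits)

lemma one_polys [simp, intro]: "1 \<in> polys d"
  by (metis Const_1 Const_polys)

lemma Var_polys [intro]: "i < d \<Longrightarrow> Var i \<in> polys d"
  by (auto simp: polys_def Var_def)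

lemma add_polys [intro]: "p \<in> polys d \<Longrightarrow> q \<in> polys d \<Longrightarrow> p + q \<in> polys d"
  using Poly_Mapping.keys_add[of p q] by (fastforce simp: polys_def)

lemma mult_polys [intro]: "p \<in> polys d \<Longrightarrow> q \<in> polys d \<Longrightarrow> p * q \<in> polys d"
proof (rule polysI)
  fix m assume p: "p \<in> polys d" "q \<in> polys d" and "m \<in> Poly_Mapping.keys (p * q)"
  then obtain a b where "m = a + b" "a \<in> Poly_Mapping.keys p" "b \<in> Poly_Mapping.keys q"
    using keys_mult[of p q] by auto
  then show "Poly_Mapping.keys m \<subseteq> {..<d}"
    using p Poly_Mapping.keys_add[of a b] by (fastforce simp: polys_def)
qed

lemma prod_polys [intro]: "(\<And>x. x \<in> A \<Longrightarrow> s x \<in> polys d) \<Longrightarrow> prod s A \<in> polys d"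
  by (induction A rule: infinite_finite_induct) auto

lemma subst_polys:
  assumes "p \<in> polys d" "\<And>i. i < d \<Longrightarrow> g i \<in> polys e"
  shows "subst g p \<in> polys e"
  using assms(1)
  by (induction p rule: polys_induct) (auto simp: assms subst_add subst_mult)

lemma forms_polys: "p \<in> forms d n \<Longrightarrow> p \<in> polys d"
  by (simp add: forms_def)

lemma zero_forms [simp, intro]: "0 \<in> forms d n"
  by (simp add: forms_def)

lemma single_forms:
  "Poly_Mapping.keys m \<subseteq> {..<d} \<Longrightarrow> Poly_Mapping.single m c \<in> forms d (mdeg m)"
  by (auto simp: forms_def polys_def split: if_splits)

lemma Const_forms [intro, simp]: "Const c \<in> forms d 0"
  using single_forms[of 0 d c] by (simp add: Const_def mdeg_def)

lemma one_forms [intro, simp]: "1 \<in> forms d 0"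
  using Const_forms[of 1 d] by simp

lemma Var_forms [intro]: "i < d \<Longrightarrow> Var i \<in> forms d 1"
  using single_forms[of "Poly_Mapping.single i 1" d 1] by (simp add: Var_def)

lemma add_forms [intro]: "p \<in> forms d n \<Longrightarrow> q \<in> forms d n \<Longrightarrow> p + q \<in> forms d n"
  using Poly_Mapping.keys_add[of p q] add_polys[of p d q] by (auto simp: forms_def)

lemma uminus_forms [intro]: "p \<in> forms d n \<Longrightarrow> - p \<in> forms d n"
  by (auto simp: forms_def polys_def in_keys_iff)

lemma diff_forms [intro]: "p \<in> forms d n \<Longrightarrow> q \<in> forms d n \<Longrightarrow> p - q \<in> forms d n"
  using add_forms[of p d n "- q"] by auto

lemma mult_forms [intro]:
  assumes p: "p \<in> forms d a" and q: "q \<in> forms d b"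
  shows "p * q \<in> forms d (a + b)"
proof -
  have "mdeg m = a + b" if m: "m \<in> Poly_Mapping.keys (p * q)" for m
  proof -
    obtain k l where "m = k + l" "k \<in> Poly_Mapping.keys p" "l \<in> Poly_Mapping.keys q"
      using keys_mult[of p q] m by auto
    then show ?thesis using p q by (auto simp: forms_def mdeg_add)
  qed
  then show ?thesis using p q mult_polys[of p d q] by (auto simp: forms_def)
qed

lemma Const_mult_forms [intro]: "p \<in> forms d n \<Longrightarrow> Const c * p \<in> forms d n"
  using mult_forms[OF Const_forms, of p d n c] by simp

lemma sum_forms [intro]: "(\<And>x. x \<in> A \<Longrightarrow> s x \<in> forms d n) \<Longrightarrow> sum s A \<in> forms d n"
  by (induction A rule: infinite_finite_induct) auto

lemma power_forms: "p \<in> forms d a \<Longrightarrow> p ^ n \<in> forms d (a * n)"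
  by (induction n) auto

lemma prod_forms:
  "finite A \<Longrightarrow> (\<And>x. x \<in> A \<Longrightarrow> s x \<in> forms d (e x)) \<Longrightarrow> prod s A \<in> forms d (sum e A)"
  by (induction A rule: finite_induct) auto

lemma forms_induct [consumes 1, case_names zero add single]:
  assumes p: "p \<in> forms d n" and "P 0" and "\<And>p q. P p \<Longrightarrow> P q \<Longrightarrow> P (p + q)"
    and "\<And>m c. Poly_Mapping.keys m \<subseteq> {..<d} \<Longrightarrow> mdeg m = n \<Longrightarrow> P (Poly_Mapping.single m c)"
  shows "P p"
proof -
  have "P (\<Sum>m \<in> A. Poly_Mapping.single m (Poly_Mapping.lookup p m))"
    if "finite A" "A \<subseteq> Poly_Mapping.keys p" for A
    using that
  proof induction
    case (insert m A)
    then have "Poly_Mapping.keys m \<subseteq> {..<d}" "mdeg m = n"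
      using p by (auto simp: forms_def polys_def)
    with insert show ?case using assms by simp
  qed (use assms in simp)
  from this[of "Poly_Mapping.keys p"] show ?thesis
    using poly_mapping_eq_sum_single[of p] by simp
qed

lemma forms_0_Const:
  assumes "p \<in> forms d 0" shows "p = Const (Poly_Mapping.lookup p 0)"
  using assms
  by (induction p rule: forms_induct)
    (auto simp: mdeg_eq_0_iff lookup_add Const_add, simp add: Const_def)

lemma subst_forms:
  assumes "p \<in> forms d n" "\<And>i. i < d \<Longrightarrow> g i \<in> forms d' e"
  shows "subst g p \<in> forms d' (e * n)"
  using assms(1)
proof (induction p rule: forms_induct)
  case (single m c)
  have "monom_eval g m \<in> forms d' (\<Sum>i\<in>Poly_Mapping.keys m. e * Poly_Mapping.lookup m i)"
    unfolding monom_eval_def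
    by (intro prod_forms power_forms assms(2)) (use single in auto)
  then show ?case
    using single
    by (auto simp: subst_eq_eval_hom eval_hom_single[OF Const_hom] mdeg_def simp flip: sum_distrib_left)
qed (auto simp: subst_add subst_eq_eval_hom eval_hom_add Const_hom)

lemma eval_hom_scale:
  assumes "p \<in> forms d n" "comm_ring_hom h"
  shows "eval_hom h (\<lambda>i. c * g i) p = c ^ n * eval_hom h g p"
  using assms(1)
proof (induction p rule: forms_induct)
  case (single m b)
  then show ?case
    by (simp add: eval_hom_single[OF assms(2)] monom_eval_def power_mult_distrib prod.distrib
        power_sum mdeg_def mult_ac flip: power_sum)
qed (auto simp: eval_hom_add assms distrib_left)

section \<open>Homogeneous components\<close>

definition hom_comp :: "nat \<Rightarrow> cpoly \<Rightarrow> cpoly" where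
  "hom_comp e p = (\<Sum>m | m \<in> Poly_Mapping.keys p \<and> mdeg m = e.
     Poly_Mapping.single m (Poly_Mapping.lookup p m))"

lemma lookup_hom_comp:
  "Poly_Mapping.lookup (hom_comp e p) m = (if mdeg m = e then Poly_Mapping.lookup p m else 0)"
  by (auto simp: hom_comp_def lookup_sum lookup_single when_def in_keys_iff sum.delta')

lemma hom_comp_add: "hom_comp e (p + q) = hom_comp e p + hom_comp e q"
  by (rule poly_mapping_eqI) (simp add: lookup_hom_comp lookup_add)

lemma hom_comp_0 [simp]: "hom_comp e 0 = 0"
  by (simp add: hom_comp_def)

lemma hom_comp_sum: "hom_comp e (sum s A) = (\<Sum>x\<in>A. hom_comp e (s x))"
  by (induction A rule: infinite_finite_induct) (auto simp: hom_comp_add)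

lemma hom_comp_forms: "p \<in> polys d \<Longrightarrow> hom_comp e p \<in> forms d e"
  by (auto simp: forms_def polys_def in_keys_iff lookup_hom_comp split: if_splits)

lemma hom_comp_of_form:
  "p \<in> forms d n \<Longrightarrow> hom_comp e p = (if e = n then p else 0)"
  by (rule poly_mapping_eqI) (auto simp: lookup_hom_comp forms_def in_keys_iff)

lemma sum_hom_comp: "p = (\<Sum>e \<in> mdeg ` Poly_Mapping.keys p. hom_comp e p)"
  by (rule poly_mapping_eqI) (auto simp: lookup_sum lookup_hom_comp sum.delta' in_keys_iff image_iff)

lemma hom_comp_mult_form:
  assumes p: "p \<in> polys d" and q: "q \<in> forms d n"
  shows "hom_comp (e + n) (p * q) = hom_comp e p * q"
proof -
  let ?A = "mdeg ` Poly_Mapping.keys p"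
  have "hom_comp (e + n) (p * q) = (\<Sum>k\<in>?A. hom_comp (e + n) (hom_comp k p * q))"
    by (subst sum_hom_comp[of p]) (simp add: sum_distrib_right hom_comp_sum)
  also have "\<dots> = (\<Sum>k\<in>?A. if e = k then hom_comp k p * q else 0)"
    by (intro sum.cong) (auto simp: hom_comp_of_form[OF mult_forms[OF hom_comp_forms[OF p] q]])
  also have "\<dots> = hom_comp e (\<Sum>k\<in>?A. hom_comp k p) * q"
    by (auto simp: hom_comp_sum sum_distrib_right hom_comp_of_form[OF hom_comp_forms[OF p]]
      intro!: sum.cong)
  finally show ?thesis using sum_hom_comp[of p] by simp
qed

text \<open>Forms of degree \<open>r > 0\<close> multiply degrees by \<open>r\<close>, so distinct components stay in distinct
  degrees after substitution. This lets a relation between polynomials in the \<open>g i\<close> be replaced by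
  one between forms.\<close>

lemma hom_comp_subst:
  assumes p: "p \<in> polys d" and g: "\<And>i. i < d \<Longrightarrow> g i \<in> forms d' r" and "r > 0"
  shows "hom_comp (r * e) (subst g p) = subst g (hom_comp e p)"
proof -
  let ?A = "mdeg ` Poly_Mapping.keys p"
  interpret comm_ring_hom "subst g" by (rule subst_hom)
  have "hom_comp (r * e) (subst g p) = (\<Sum>k\<in>?A. hom_comp (r * e) (subst g (hom_comp k p)))"
    by (subst sum_hom_comp[of p]) (simp add: hom_sum hom_comp_sum)
  also have "\<dots> = (\<Sum>k\<in>?A. if e = k then subst g (hom_comp k p) else 0)"
    using \<open>r > 0\<close>
    by (intro sum.cong) (auto simp: hom_comp_of_form[OF subst_forms[OF hom_comp_forms[OF p] g]])
  also have "\<dots> = subst g (hom_comp e (\<Sum>k\<in>?A. hom_comp k p))"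
    by (auto simp: hom_comp_sum hom_sum hom_comp_of_form[OF hom_comp_forms[OF p]]
      intro!: sum.cong)
  finally show ?thesis using sum_hom_comp[of p] by simp
qed

section \<open>Derivatives\<close>

lemma pdiff_superset:
  assumes "finite A" "Poly_Mapping.keys p \<subseteq> A"
  shows "pdiff i p = (\<Sum>m \<in> A. Poly_Mapping.single (m - Poly_Mapping.single i 1)
       (of_nat (Poly_Mapping.lookup m i) * Poly_Mapping.lookup p m))"
  unfolding pdiff_def using assms
  by (intro sum.mono_neutral_left) (auto simp: in_keys_iff)

lemma pdiff_0 [simp]: "pdiff i 0 = 0"
  by (simp add: pdiff_def)

lemma pdiff_add: "pdiff i (p + q) = pdiff i p + pdiff i q"
proof -
  let ?A = "Poly_Mapping.keys p \<union> Poly_Mapping.keys q"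
  have "finite ?A" by simp
  then show ?thesis
    using pdiff_superset[of ?A "p + q" i] pdiff_superset[of ?A p i]
      pdiff_superset[of ?A q i] Poly_Mapping.keys_add[of p q]
    by (simp add: lookup_add sum.distrib single_add distrib_left)
qed

lemma pdiff_single:
  "pdiff i (Poly_Mapping.single m c) =
     Poly_Mapping.single (m - Poly_Mapping.single i 1) (of_nat (Poly_Mapping.lookup m i) * c)"
  using pdiff_superset[of "{m}" "Poly_Mapping.single m c" i] by simp

lemma pdiff_Const [simp]: "pdiff i (Const c) = 0"
  by (simp add: Const_def pdiff_single)

lemma pdiff_Var: "pdiff i (Var j) = (if i = j then 1 else 0)"
  by (auto simp: Var_def pdiff_single lookup_single)

lemma pdiff_mult: "pdiff i (p * q) = pdiff i p * q + p * pdiff i q"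
proof (induction p rule: poly_mapping_term_induct)
  case (single m c)
  show ?case
  proof (induction q rule: poly_mapping_term_induct)
    case (single n b)
    have *: "a - Poly_Mapping.single i 1 + a' = a + a' - Poly_Mapping.single i 1"
      if "Poly_Mapping.lookup a i \<noteq> 0" for a a' :: monomial
      using that by (intro poly_mapping_eqI) (auto simp: lookup_add lookup_minus lookup_single when_def)
    have 1: "Poly_Mapping.single (m - Poly_Mapping.single i 1 + n) (of_nat (Poly_Mapping.lookup m i) * c * b)
      = Poly_Mapping.single (m + n - Poly_Mapping.single i 1) (of_nat (Poly_Mapping.lookup m i) * c * b)"
      using *[of m n] by (cases "Poly_Mapping.lookup m i = 0") auto
    have 2: "Poly_Mapping.single (m + (n - Poly_Mapping.single i 1)) (of_nat (Poly_Mapping.lookup n i) * c * b)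
      = Poly_Mapping.single (m + n - Poly_Mapping.single i 1) (of_nat (Poly_Mapping.lookup n i) * c * b)"
      using *[of n m] by (cases "Poly_Mapping.lookup n i = 0") (auto simp: add.commute)
    show ?case
      using 1 2
      by (simp add: mult_single pdiff_single lookup_add algebra_simps flip: single_add)
  qed (simp_all add: pdiff_add distrib_left)
qed (simp_all add: pdiff_add distrib_right)

lemma pdiff_commute: "pdiff i (pdiff j p) = pdiff j (pdiff i p)"
  by (induction p rule: cpoly_induct)
    (simp_all add: pdiff_add pdiff_mult pdiff_Var add_ac flip: Const_1)

lemma pdiff_forms:
  assumes "p \<in> forms d n" shows "pdiff i p \<in> forms d (n - 1)"
  using assms
proof (induction p rule: forms_induct)
  case (single m c)
  let ?e = "Poly_Mapping.single i (1::nat)"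
  show ?case
  proof (cases "Poly_Mapping.lookup m i = 0")
    case False
    then have m: "m = (m - ?e) + ?e"
      by (intro poly_mapping_eqI) (auto simp: lookup_add lookup_minus lookup_single when_def)
    have "mdeg m = mdeg (m - ?e) + 1" by (subst m) (simp add: mdeg_add)
    moreover have "Poly_Mapping.keys (m - ?e) \<subseteq> {..<d}"
      using single(1) by (auto simp: in_keys_iff lookup_minus subset_iff intro: gr_zeroI)
    ultimately show ?thesis
      using single_forms[of "m - ?e" d "of_nat (Poly_Mapping.lookup m i) * c"] single
      by (simp add: pdiff_single)
  qed (simp add: pdiff_single)
qed (auto simp: pdiff_add)

lemma Euler_identity:
  assumes "p \<in> forms d n"
  shows "(\<Sum>i<d. Var i * pdiff i p) = of_nat n * p"
  using assms
proof (induction p rule: forms_induct)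
  case (single m c)
  let ?e = "\<lambda>i. Poly_Mapping.single i (1::nat)"
  have *: "Var i * pdiff i (Poly_Mapping.single m c)
      = Poly_Mapping.single m (of_nat (Poly_Mapping.lookup m i) * c)" for i
  proof (cases "Poly_Mapping.lookup m i = 0")
    case False
    then have "?e i + (m - ?e i) = m"
      by (intro poly_mapping_eqI) (auto simp: lookup_add lookup_minus lookup_single when_def)
    then show ?thesis by (simp add: Var_def pdiff_single mult_single)
  qed (simp add: pdiff_single)
  have "(\<Sum>i<d. Poly_Mapping.single m (of_nat (Poly_Mapping.lookup m i) * c))
      = Poly_Mapping.single m (of_nat (\<Sum>i<d. Poly_Mapping.lookup m i) * c)" for d
    by (induction d) (simp_all add: distrib_right flip: single_add)
  also have "(\<Sum>i<d. Poly_Mapping.lookup m i) = n"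
    using single mdeg_superset[of "{..<d}" m] by simp
  also have "Poly_Mapping.single m (of_nat n * c) = of_nat n * Poly_Mapping.single m c"
    by (metis Const_def Const_of_nat add_0 mult_single)
  finally show ?case by (simp add: *)
qed (simp_all add: pdiff_add distrib_left sum.distrib)

lemma chain_rule:
  assumes "p \<in> polys d"
  shows "pdiff j (subst g p) = (\<Sum>i<d. subst g (pdiff i p) * pdiff j (g i))"
  using assms
proof (induction p rule: polys_induct)
  case (Const c)
  then show ?case by (simp flip: Const_0)
next
  case (Var i)
  have "(\<Sum>k<d. subst g (pdiff k (Var i)) * pdiff j (g k)) = (\<Sum>k<d. if k = i then pdiff j (g k) else 0)"
    by (intro sum.cong) (auto simp: pdiff_Var simp flip: Const_0 Const_1)
  then show ?case using Var by simp
next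
  case (add p q)
  then show ?case by (simp add: pdiff_add subst_add distrib_right sum.distrib)
next
  case (mult p q)
  have "subst g (pdiff i (p * q)) * pdiff j (g i) =
     (subst g (pdiff i p) * pdiff j (g i)) * subst g q +
     subst g p * (subst g (pdiff i q) * pdiff j (g i))" for i
    by (simp add: pdiff_mult subst_add subst_mult algebra_simps)
  then show ?case
    by (simp add: pdiff_mult subst_mult mult sum.distrib sum_distrib_left sum_distrib_right)
qed

section \<open>Determinants and ideals\<close>

text \<open>Multiplying the system by the adjugate matrix. Working modulo an ideal \<open>N\<close> of an arbitrary
  commutative ring covers both uses: the zero ideal of the polynomial ring, and the ideal that encodes
  the relations of \<open>L \<otimes>\<^sub>K L\<close>.\<close>

lemma determinant_trick:
  fixes A :: "'a::comm_ring_1 mat"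
  assumes A: "A \<in> carrier_mat n n"
    and N: "0 \<in> N" "\<And>x y. x \<in> N \<Longrightarrow> y \<in> N \<Longrightarrow> x + y \<in> N" "\<And>r x. x \<in> N \<Longrightarrow> r * x \<in> N"
    and t: "\<And>i. i < n \<Longrightarrow> (\<Sum>j<n. A $$ (i, j) * t j) \<in> N" and j: "j < n"
  shows "det A * t j \<in> N"
proof -
  let ?B = "adj_mat A"
  have sumN: "sum s I \<in> N" if "\<And>x. x \<in> I \<Longrightarrow> s x \<in> N" for s :: "nat \<Rightarrow> 'a" and I
    using that by (induction I rule: infinite_finite_induct) (auto simp: N)
  note B = adj_mat[OF A]
  have entry: "(\<Sum>i<n. ?B $$ (j, i) * A $$ (i, m)) = (if j = m then det A else 0)" if "m < n" for m
  proof -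
    have "(\<Sum>i<n. ?B $$ (j, i) * A $$ (i, m)) = (?B * A) $$ (j, m)"
      using A B(1) j that by (auto simp: scalar_prod_def atLeast0LessThan intro!: sum.cong)
    then show ?thesis using B(3) j that by simp
  qed
  have "(\<Sum>i<n. ?B $$ (j, i) * (\<Sum>m<n. A $$ (i, m) * t m))
      = (\<Sum>m<n. (\<Sum>i<n. ?B $$ (j, i) * A $$ (i, m)) * t m)"
    unfolding sum_distrib_left sum_distrib_right mult.assoc by (rule sum.swap)
  also have "\<dots> = (\<Sum>m<n. if j = m then det A * t m else 0)"
    by (intro sum.cong) (auto simp: entry)
  also have "\<dots> = det A * t j" using j by simp
  finally show ?thesis
    using sumN[of "{..<n}" "\<lambda>i. ?B $$ (j, i) * (\<Sum>m<n. A $$ (i, m) * t m)"] t N(3) by simp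
qed

section \<open>The polar map of a cubic form\<close>

lemma linear_form_expand:
  assumes "p \<in> forms d 1"
  shows "p = (\<Sum>i<d. Const (Poly_Mapping.lookup (pdiff i p) 0) * Var i)"
proof -
  have "pdiff i p = Const (Poly_Mapping.lookup (pdiff i p) 0)" for i
    using pdiff_forms[OF assms, of i] by (intro forms_0_Const[of _ d]) simp
  then show ?thesis using Euler_identity[OF assms] by (simp add: mult.commute)
qed

lemma eval_linear_form:
  assumes "p \<in> forms d 1" "comm_ring_hom h"
  shows "eval_hom h g p = (\<Sum>i<d. h (Poly_Mapping.lookup (pdiff i p) 0) * g i)"
proof -
  interpret comm_ring_hom "eval_hom h g" by (rule eval_hom_hom) fact
  show ?thesis
    by (subst linear_form_expand[OF assms(1)])
      (simp add: hom_sum eval_hom_mult eval_hom_Const eval_hom_Var assms)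
qed

lemma eval_linear_form_add:
  assumes "p \<in> forms d 1" "comm_ring_hom h"
  shows "eval_hom h (\<lambda>i. a i + b i) p = eval_hom h a p + eval_hom h b p"
  by (simp add: eval_linear_form[OF assms] distrib_left sum.distrib)

lemma cubic_hess_forms: "f \<in> forms d 3 \<Longrightarrow> pdiff i (pdiff j f) \<in> forms d 1"
  using pdiff_forms[of "pdiff j f" d 2 i] pdiff_forms[of f d 3 j] by simp

lemma cubic_polar_forms: "f \<in> forms d 3 \<Longrightarrow> pdiff i f \<in> forms d 2"
  using pdiff_forms[of f d 3 i] by simp

lemma eval_polar:
  assumes f: "f \<in> forms d 3" and h: "comm_ring_hom h"
  shows "2 * eval_hom h a (pdiff i f) = (\<Sum>j<d. eval_hom h a (pdiff i (pdiff j f)) * a j)"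
proof -
  interpret comm_ring_hom "eval_hom h a" by (rule eval_hom_hom) fact
  have "2 * pdiff i f = (\<Sum>j<d. Var j * pdiff j (pdiff i f))"
    using Euler_identity[OF cubic_polar_forms[OF f], of i] by simp
  then have "eval_hom h a (2 * pdiff i f) = eval_hom h a (\<Sum>j<d. Var j * pdiff j (pdiff i f))"
    by simp
  moreover have "eval_hom h a (2 * pdiff i f) = 2 * eval_hom h a (pdiff i f)"
    by (metis hom_add mult_2)
  ultimately show ?thesis
    by (simp add: hom_sum eval_hom_mult eval_hom_Var h mult.commute pdiff_commute[of i])
qed

text \<open>Both sides are the symmetric trilinear form of \<open>f\<close> at \<open>a\<close>, \<open>b\<close> and the \<open>i\<close>-th basis vector.\<close>

lemma eval_hess_symmetric:
  assumes f: "f \<in> forms d 3" and h: "comm_ring_hom h"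
  shows "(\<Sum>j<d. eval_hom h a (pdiff i (pdiff j f)) * b j)
    = (\<Sum>j<d. eval_hom h b (pdiff i (pdiff j f)) * a j)"
proof -
  have *: "(\<Sum>j<d. eval_hom h a (pdiff i (pdiff j f)) * b j)
    = (\<Sum>j<d. \<Sum>k<d. h (Poly_Mapping.lookup (pdiff k (pdiff i (pdiff j f))) 0) * a k * b j)" for a b
    by (simp add: eval_linear_form[OF cubic_hess_forms[OF f] h] sum_distrib_right)
  have sym: "pdiff k (pdiff i (pdiff j f)) = pdiff j (pdiff i (pdiff k f))" for j k
    by (metis pdiff_commute)
  show ?thesis
    unfolding * by (subst sum.swap, intro sum.cong refl) (simp add: sym mult_ac)
qed

text \<open>By symmetry of the second derivatives this is \<open>x\<^sup>2 - y\<^sup>2 = (x + y) (x - y)\<close> for the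
  quadratic map \<open>F\<close>.\<close>

lemma polar_difference:
  assumes f: "f \<in> forms d 3" and h: "comm_ring_hom h"
  shows "(\<Sum>j<d. eval_hom h (\<lambda>i. a i + b i) (pdiff i (pdiff j f)) * (a j - b j))
    = 2 * (eval_hom h a (pdiff i f) - eval_hom h b (pdiff i f))"
  using eval_hess_symmetric[OF f h, of a i b]
  by (simp add: eval_linear_form_add[OF cubic_hess_forms[OF f] h] right_diff_distrib
      eval_polar[OF f h] distrib_right sum.distrib sum_subtractf)

lemma eval_Hess:
  assumes h: "comm_ring_hom h"
  shows "det (mat d d (\<lambda>(i, j). eval_hom h g (pdiff i (pdiff j f)))) = eval_hom h g (Hess d f)"
proof -
  interpret comm_ring_hom "eval_hom h g" by (rule eval_hom_hom) fact
  have "map_mat (eval_hom h g) (mat d d (\<lambda>(i, j). pdiff i (pdiff j f)))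
    = mat d d (\<lambda>(i, j). eval_hom h g (pdiff i (pdiff j f)))"
    by (intro eq_matI) auto
  then show ?thesis unfolding Hess_def by (metis hom_det)
qed

lemma polar_fibre_half:
  assumes f: "f \<in> forms d 3" and h: "comm_ring_hom h"
    and N: "0 \<in> N" "\<And>x y. x \<in> N \<Longrightarrow> y \<in> N \<Longrightarrow> x + y \<in> N" "\<And>r x. x \<in> N \<Longrightarrow> r * x \<in> N"
    and F: "\<And>i. i < d \<Longrightarrow> eval_hom h a (pdiff i f) - eval_hom h b (pdiff i f) \<in> N"
    and "j < d"
  shows "eval_hom h (\<lambda>i. a i + b i) (Hess d f) * (a j - b j) \<in> N"
  unfolding eval_Hess[OF h, symmetric]
proof (rule determinant_trick[of _ d, OF _ N])
  fix i assume i: "i < d"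
  have "(\<Sum>j<d. eval_hom h (\<lambda>i. a i + b i) (pdiff i (pdiff j f)) * (a j - b j)) \<in> N"
    unfolding polar_difference[OF f h] using F[OF i] N(3) by blast
  then show "(\<Sum>j<d. mat d d (\<lambda>(i, j). eval_hom h (\<lambda>i. a i + b i) (pdiff i (pdiff j f))) $$ (i, j)
      * (a j - b j)) \<in> N"
    using i by simp
qed (use \<open>j < d\<close> in auto)

text \<open>The ideal-theoretic form of: if \<open>F(a) = F(b)\<close> and \<open>l(a)\<close> is invertible, then \<open>b = a\<close> or
  \<open>b = - a\<close>. With \<open>s = a + b\<close> and \<open>t = a - b\<close>, modulo \<open>N\<close> the power \<open>l(s) ^ k\<close> annihilates every
  \<open>t j\<close>, and \<open>l(t) ^ k\<close> annihilates every \<open>s i\<close>. Hence a power of \<open>l(s) + l(t) = 2 l(a)\<close> annihilates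
  the products \<open>s i * t j\<close>, from which \<open>a i * a j - b i * b j\<close> is built.\<close>

lemma polar_fibre:
  assumes f: "f \<in> forms d 3" and h: "comm_ring_hom h"
    and l: "l \<in> forms d 1" and Hess: "Hess d f = l ^ k"
    and N: "0 \<in> N" "\<And>x y. x \<in> N \<Longrightarrow> y \<in> N \<Longrightarrow> x + y \<in> N" "\<And>r x. x \<in> N \<Longrightarrow> r * x \<in> N"
    and F: "\<And>i. i < d \<Longrightarrow> eval_hom h a (pdiff i f) - eval_hom h b (pdiff i f) \<in> N"
    and ij: "i < d" "j < d"
  shows "(2 * eval_hom h a l) ^ (2 * k) * (2 * (a i * a j - b i * b j)) \<in> N"
proof -
  define s where "s i = a i + b i" for i
  define t where "t i = a i - b i" for i
  define p where "p = eval_hom h s l"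
  define q where "q = eval_hom h t l"
  interpret s: comm_ring_hom "eval_hom h s" by (rule eval_hom_hom) fact
  interpret t: comm_ring_hom "eval_hom h t" by (rule eval_hom_hom) fact
  have neg: "eval_hom h (\<lambda>i. - b i) r = (- 1) ^ n * eval_hom h b r" if "r \<in> forms d n" for r n
    using eval_hom_scale[OF that h, of "- 1" b] by simp
  have s': "s = (\<lambda>i. a i + b i)" by (simp add: s_def fun_eq_iff)
  have t': "t = (\<lambda>i. a i + - b i)" by (simp add: t_def fun_eq_iff)
  have 1: "p ^ k * t j \<in> N" if "j < d" for j
    using polar_fibre_half[OF f h N F that] Hess
    by (simp only: s'[symmetric] s.hom_power p_def t_def)
  \<comment> \<open>The polar map is even, so the same holds for \<open>a\<close> and \<open>- b\<close>.\<close>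
  have 2: "q ^ k * s j \<in> N" if "j < d" for j
  proof -
    have "eval_hom h (\<lambda>i. a i + - b i) (Hess d f) * (a j - - b j) \<in> N"
      using F that
      by (intro polar_fibre_half[OF f h N]) (simp_all add: neg[OF cubic_polar_forms[OF f]])
    then show ?thesis using Hess by (simp only: t'[symmetric] t.hom_power q_def s_def) simp
  qed
  have "q = eval_hom h a l - eval_hom h b l" "p = eval_hom h a l + eval_hom h b l"
    unfolding p_def q_def t' s' by (simp_all only: eval_linear_form_add[OF l h] neg[OF l]) simp_all
  then have pq: "2 * eval_hom h a l = p + q" by simp
  have sumN: "sum u I \<in> N" if "\<And>x. x \<in> I \<Longrightarrow> u x \<in> N" for u :: "nat \<Rightarrow> _" and I
    using that by (induction I rule: infinite_finite_induct) (auto simp: N)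
  \<comment> \<open>In each term of the binomial expansion one of the two exponents is at least \<open>k\<close>.\<close>
  have st: "(p + q) ^ (2 * k) * (s i * t j) \<in> N" if ij: "i < d" "j < d" for i j
  proof -
    have "of_nat (2 * k choose r) * p ^ r * q ^ (2 * k - r) * (s i * t j) \<in> N" for r
    proof (cases "r \<ge> k")
      case True
      then have "p ^ r = p ^ (r - k) * p ^ k" by (simp flip: power_add)
      then have "of_nat (2 * k choose r) * p ^ r * q ^ (2 * k - r) * (s i * t j)
        = (of_nat (2 * k choose r) * p ^ (r - k) * q ^ (2 * k - r) * s i) * (p ^ k * t j)"
        by (simp add: mult_ac)
      then show ?thesis using N(3)[OF 1[OF ij(2)]] by simp
    next
      case False
      then have "2 * k - r = (2 * k - r - k) + k" by simp
      then have "q ^ (2 * k - r) = q ^ (2 * k - r - k) * q ^ k" by (metis power_add)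
      then have "of_nat (2 * k choose r) * p ^ r * q ^ (2 * k - r) * (s i * t j)
        = (of_nat (2 * k choose r) * p ^ r * q ^ (2 * k - r - k) * t j) * (q ^ k * s i)"
        by (simp add: mult_ac)
      then show ?thesis using N(3)[OF 2[OF ij(1)]] by simp
    qed
    then show ?thesis unfolding binomial_ring sum_distrib_right by (intro sumN)
  qed
  have "2 * (a i * a j - b i * b j) = s i * t j + s j * t i"
    by (simp add: s_def t_def algebra_simps)
  then have "(p + q) ^ (2 * k) * (2 * (a i * a j - b i * b j))
      = (p + q) ^ (2 * k) * (s i * t j) + (p + q) ^ (2 * k) * (s j * t i)"
    by (simp only: distrib_left)
  then show ?thesis unfolding pq using N(2)[OF st[OF ij] st[OF ij(2,1)]] by simp
qed

section \<open>Linear functionals over a subfield\<close>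

text \<open>A \<open>K\<close>-subspace \<open>W\<close> that is maximal among those containing \<open>1\<close> and avoiding \<open>z\<close> has
  codimension one. The functional is the \<open>z\<close>-coordinate modulo \<open>W\<close>.\<close>

lemma subfield_separating_functional:
  fixes K :: "'a::field set"
  assumes K: "1 \<in> K" "\<And>x y. x \<in> K \<Longrightarrow> y \<in> K \<Longrightarrow> x + y \<in> K" "\<And>x. x \<in> K \<Longrightarrow> - x \<in> K"
      "\<And>x y. x \<in> K \<Longrightarrow> y \<in> K \<Longrightarrow> x * y \<in> K" "\<And>x. x \<in> K \<Longrightarrow> inverse x \<in> K"
    and z: "z \<notin> K"
  shows "\<exists>\<phi>. (\<forall>x y. \<phi> (x + y) = \<phi> x + \<phi> y) \<and> (\<forall>k\<in>K. \<forall>x. \<phi> (k * x) = k * \<phi> x) \<and>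
    \<phi> 1 = 0 \<and> \<phi> z = 1"
proof -
  have K0: "0 \<in> K" using K(2)[OF K(1) K(3)[OF K(1)]] by simp
  define S where "S = {W. 1 \<in> W \<and> z \<notin> W \<and> (\<forall>x\<in>W. \<forall>y\<in>W. x + y \<in> W) \<and> (\<forall>k\<in>K. \<forall>x\<in>W. k * x \<in> W)}"
  have "\<exists>W\<in>S. \<forall>X\<in>S. W \<subseteq> X \<longrightarrow> X = W"
  proof (rule subset_Zorn_nonempty)
    have "K \<in> S" using K z by (auto simp: S_def)
    then show "S \<noteq> {}" by blast
  next
    fix C assume C: "C \<noteq> {}" "subset.chain S C"
    have "x + y \<in> \<Union>C" if "x \<in> \<Union>C" "y \<in> \<Union>C" for x y
    proof -
      obtain A B where AB: "A \<in> C" "B \<in> C" "x \<in> A" "y \<in> B" using \<open>x \<in> \<Union>C\<close> \<open>y \<in> \<Union>C\<close> by blast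
      then have "A \<subseteq> B \<or> B \<subseteq> A" "A \<in> S" "B \<in> S"
        using C(2) by (auto simp: subset_chain_def)
      then show ?thesis using AB unfolding S_def by blast
    qed
    moreover have inS: "A \<in> S" if "A \<in> C" for A using C(2) that by (auto simp: subset_chain_def)
    moreover have "1 \<in> \<Union>C" "z \<notin> \<Union>C" "\<forall>k\<in>K. \<forall>x\<in>\<Union>C. k * x \<in> \<Union>C"
      using C(1) inS unfolding S_def by blast+
    ultimately show "\<Union>C \<in> S" unfolding S_def by blast
  qed
  then obtain W where "W \<in> S" and max: "\<And>X. X \<in> S \<Longrightarrow> W \<subseteq> X \<Longrightarrow> X = W" by blast
  then have W: "1 \<in> W" "z \<notin> W" "\<And>x y. x \<in> W \<Longrightarrow> y \<in> W \<Longrightarrow> x + y \<in> W"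
      "\<And>k x. k \<in> K \<Longrightarrow> x \<in> W \<Longrightarrow> k * x \<in> W"
    by (auto simp: S_def)
  have W0: "0 \<in> W" using W(4)[OF K0 W(1)] by simp
  have ex: "\<exists>k\<in>K. v - k * z \<in> W" for v
  proof (cases "v \<in> W")
    case True
    then show ?thesis using K0 by (intro bexI[of _ 0]) auto
  next
    case False
    \<comment> \<open>The subspace spanned by \<open>W\<close> and \<open>v\<close> is too large to avoid \<open>z\<close>.\<close>
    define X where "X = {w + k * v | w k. w \<in> W \<and> k \<in> K}"
    have "W \<subseteq> X" using K0 by (force simp: X_def)
    have "0 + 1 * v \<in> X" unfolding X_def using W0 K(1) by blast
    then have "X \<notin> S" using False max[OF _ \<open>W \<subseteq> X\<close>] by auto
    moreover have "x + y \<in> X" if xy: "x \<in> X" "y \<in> X" for x y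
    proof -
      obtain w k w' k' where "x = w + k * v" "y = w' + k' * v" "w \<in> W" "w' \<in> W" "k \<in> K" "k' \<in> K"
        using xy by (auto simp: X_def)
      then have "x + y = (w + w') + (k + k') * v" "w + w' \<in> W" "k + k' \<in> K"
        using W(3) K(2) by (simp_all add: distrib_right)
      then show ?thesis unfolding X_def by blast
    qed
    moreover have "c * x \<in> X" if cx: "c \<in> K" "x \<in> X" for c x
    proof -
      obtain w k where "x = w + k * v" "w \<in> W" "k \<in> K"
        using cx by (auto simp: X_def)
      then have "c * x = c * w + (c * k) * v" "c * w \<in> W" "c * k \<in> K"
        using W(4) K(4) cx(1) by (simp_all add: distrib_left mult.assoc)
      then show ?thesis unfolding X_def by blast
    qed
    moreover have "1 \<in> X" using \<open>W \<subseteq> X\<close> W(1) by blast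
    ultimately have "z \<in> X" unfolding S_def by blast
    then obtain w k where wk: "z = w + k * v" "w \<in> W" "k \<in> K" unfolding X_def by blast
    then have "k \<noteq> 0" using W(2) by auto
    then have "v - inverse k * z = - inverse k * w"
      using wk(1) by (simp add: distrib_left flip: mult.assoc)
    moreover have "- inverse k * w \<in> W" using W(4)[OF K(3)[OF K(5)]] wk by blast
    ultimately show ?thesis using K(5)[OF wk(3)] by (intro bexI[of _ "inverse k"]) auto
  qed
  have unique: "k = k'" if k: "k \<in> K" "k' \<in> K" "v - k * z \<in> W" "v - k' * z \<in> W" for k k' v
  proof (rule ccontr)
    assume "k \<noteq> k'"
    have "(v - k * z) + (- 1) * (v - k' * z) \<in> W"
      by (intro W(3,4) K(1,3) k)
    moreover have "(v - k * z) + (- 1) * (v - k' * z) = (k' - k) * z" by (simp add: algebra_simps)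
    moreover have "inverse (k' - k) \<in> K" using K(2)[OF k(2) K(3)[OF k(1)]] K(5) by simp
    ultimately have "inverse (k' - k) * ((k' - k) * z) \<in> W" using W(4) by metis
    moreover have "inverse (k' - k) * ((k' - k) * z) = z"
      using \<open>k \<noteq> k'\<close> by (simp flip: mult.assoc)
    ultimately show False using W(2) by simp
  qed
  define \<phi> where "\<phi> v = (SOME k. k \<in> K \<and> v - k * z \<in> W)" for v
  have \<phi>: "\<phi> v \<in> K" "v - \<phi> v * z \<in> W" for v
    using someI_ex[of "\<lambda>k. k \<in> K \<and> v - k * z \<in> W"] ex[of v] unfolding \<phi>_def by auto
  have eqI: "\<phi> v = k" if "k \<in> K" "v - k * z \<in> W" for v k
    using unique[OF \<phi>(1) that(1) \<phi>(2) that(2)] .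
  show ?thesis
  proof (intro exI[of _ \<phi>] conjI allI ballI)
    fix x y
    have eq: "(x + y) - (\<phi> x + \<phi> y) * z = (x - \<phi> x * z) + (y - \<phi> y * z)"
      by (simp add: algebra_simps)
    show "\<phi> (x + y) = \<phi> x + \<phi> y"
      by (rule eqI, rule K(2)[OF \<phi>(1) \<phi>(1)], unfold eq, rule W(3)[OF \<phi>(2) \<phi>(2)])
  next
    fix k x assume k: "k \<in> K"
    have eq: "k * x - (k * \<phi> x) * z = k * (x - \<phi> x * z)" by (simp add: algebra_simps)
    show "\<phi> (k * x) = k * \<phi> x"
      by (rule eqI, rule K(4)[OF k \<phi>(1)], unfold eq, rule W(4)[OF k \<phi>(2)])
  next
    show "\<phi> 1 = 0" using W(1) K0 by (intro eqI) simp_all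
    show "\<phi> z = 1" using W0 K(1) by (intro eqI) simp_all
  qed
qed
section \<open>Products of coordinates are rational functions of the polar map\<close>

text \<open>A polynomial with coefficients in the field of fractions \<open>L\<close> represents an element of
  \<open>L \<otimes>\<^sub>K L\<close>, its coefficients being the left and its monomials the right factors. An additive map
  \<open>\<phi>\<close> on \<open>L\<close> contracts \<open>u \<otimes> v\<close> to \<open>u * \<phi> v\<close>.\<close>

definition contract :: "(cpoly fract \<Rightarrow> cpoly fract) \<Rightarrow> (monomial \<Rightarrow>\<^sub>0 cpoly fract) \<Rightarrow> cpoly fract" where
  "contract \<phi> t = (\<Sum>m \<in> Poly_Mapping.keys t.
     Poly_Mapping.lookup t m * \<phi> (to_fract (Poly_Mapping.single m 1)))"

lemma contract_superset:
  assumes "finite A" "Poly_Mapping.keys t \<subseteq> A"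
  shows "contract \<phi> t = (\<Sum>m \<in> A.
     Poly_Mapping.lookup t m * \<phi> (to_fract (Poly_Mapping.single m 1)))"
  unfolding contract_def using assms
  by (intro sum.mono_neutral_left) (auto simp: in_keys_iff)

lemma contract_add: "contract \<phi> (s + t) = contract \<phi> s + contract \<phi> t"
proof -
  let ?A = "Poly_Mapping.keys s \<union> Poly_Mapping.keys t"
  have "finite ?A" by simp
  then show ?thesis
    using contract_superset[of ?A "s + t" \<phi>] contract_superset[of ?A s \<phi>]
      contract_superset[of ?A t \<phi>] Poly_Mapping.keys_add[of s t]
    by (simp add: lookup_add sum.distrib distrib_right)
qed

lemma contract_0 [simp]: "contract \<phi> 0 = 0"
  by (simp add: contract_def)

lemma contract_diff: "contract \<phi> (s - t) = contract \<phi> s - contract \<phi> t"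
  using contract_add[of \<phi> "s - t" t] by simp

lemma contract_single:
  "contract \<phi> (Poly_Mapping.single m c) = c * \<phi> (to_fract (Poly_Mapping.single m 1))"
  using contract_superset[of "{m}" "Poly_Mapping.single m c" \<phi>] by simp

definition outer_const :: "complex \<Rightarrow> monomial \<Rightarrow>\<^sub>0 cpoly fract" where
  "outer_const c = Poly_Mapping.single 0 (to_fract (Const c))"

text \<open>The elements \<open>p \<otimes> 1\<close> and \<open>1 \<otimes> p\<close>.\<close>

definition left_copy :: "cpoly \<Rightarrow> monomial \<Rightarrow>\<^sub>0 cpoly fract" where
  "left_copy = eval_hom outer_const (\<lambda>i. Poly_Mapping.single 0 (to_fract (Var i)))"

definition right_copy :: "cpoly \<Rightarrow> monomial \<Rightarrow>\<^sub>0 cpoly fract" where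
  "right_copy = eval_hom outer_const (\<lambda>i. Poly_Mapping.single (Poly_Mapping.single i 1) 1)"

lemma outer_const_hom: "comm_ring_hom outer_const"
  by unfold_locales (simp_all add: outer_const_def single_add mult_single Const_add Const_mult)

lemma left_copy_eq: "left_copy p = Poly_Mapping.single 0 (to_fract p)"
  by (induction p rule: cpoly_induct)
    (simp_all add: left_copy_def eval_hom_Const eval_hom_Var eval_hom_add eval_hom_mult
      outer_const_hom single_add mult_single, simp add: outer_const_def)

lemma contract_mult_left: "contract \<phi> (u * left_copy p) = to_fract p * contract \<phi> u"
  by (induction u rule: poly_mapping_term_induct)
    (simp_all add: left_copy_eq contract_add distrib_right distrib_left mult_single
      contract_single mult_ac)

text \<open>A factor \<open>1 \<otimes> p\<close> can be absorbed into the functional. With \<open>\<phi>\<close> variable the statement is stable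
  under products of polynomials, so that an induction over \<open>p\<close> is possible.\<close>

lemma contract_mult_right:
  assumes "\<And>x y. \<phi> (x + y) = \<phi> x + \<phi> y" "\<And>c x. \<phi> (to_fract (Const c) * x) = to_fract (Const c) * \<phi> x"
  shows "contract \<phi> (u * right_copy p) = contract (\<lambda>x. \<phi> (to_fract p * x)) u"
  using assms
proof (induction p arbitrary: u \<phi> rule: cpoly_induct)
  case (Const c)
  show ?case
    by (induction u rule: poly_mapping_term_induct)
      (simp_all add: right_copy_def eval_hom_Const outer_const_hom distrib_right contract_add
        contract_single outer_const_def mult_single Const)
next
  case (Var i)
  show ?case
  proof (induction u rule: poly_mapping_term_induct)
    case (single m c)
    have "to_fract (Poly_Mapping.single (m + Poly_Mapping.single i 1) 1)
      = to_fract (Var i) * to_fract (Poly_Mapping.single m 1)"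
      unfolding to_fract_mult[symmetric] by (simp add: Var_def mult_single add.commute)
    then show ?case
      by (simp add: right_copy_def eval_hom_Var outer_const_hom contract_single mult_single)
  qed (simp_all add: distrib_right contract_add)
next
  case (add p q)
  have "contract (\<lambda>x. \<phi> (to_fract (p + q) * x)) u
    = contract (\<lambda>x. \<phi> (to_fract p * x)) u + contract (\<lambda>x. \<phi> (to_fract q * x)) u"
    by (simp add: contract_def sum.distrib distrib_left distrib_right add.prems)
  then show ?case
    using add by (simp add: right_copy_def eval_hom_add outer_const_hom distrib_left contract_add)
next
  case (mult p q)
  have "contract \<phi> (u * right_copy (p * q)) = contract \<phi> ((u * right_copy p) * right_copy q)"
    by (simp add: right_copy_def eval_hom_mult outer_const_hom mult_ac)
  also have "\<dots> = contract (\<lambda>x. \<phi> (to_fract q * x)) (u * right_copy p)"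
    by (rule mult.IH(2)) (use mult.prems in auto)
  also have "\<dots> = contract (\<lambda>x. \<phi> (to_fract q * (to_fract p * x))) u"
    by (rule mult.IH(1)) (simp add: distrib_left mult.prems(1), subst mult.left_commute, rule mult.prems(2))
  finally show ?case by (simp add: mult_ac)
qed

text \<open>If \<open>z = x\<^sub>i x\<^sub>j\<close> were not in \<open>K\<close>, take \<open>\<phi>\<close> with \<open>\<phi> 1 = 0\<close> and \<open>\<phi> z = 1\<close>. The tensors all of whose
  multiples contract to zero form an ideal. It contains \<open>F\<^sub>i \<otimes> 1 - 1 \<otimes> F\<^sub>i\<close> as \<open>\<phi>\<close> is
  \<open>K\<close>-linear, so by \<open>polar_fibre\<close> it contains a nonzero element of \<open>L\<close> times
  \<open>z \<otimes> 1 - 1 \<otimes> z\<close>. But that contracts to a nonzero multiple of \<open>z * \<phi> 1 - \<phi> z = - 1\<close>.\<close>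

lemma coordinate_products_in_subfield:
  assumes f: "f \<in> forms d 3" and l: "l \<in> forms d 1" "l \<noteq> 0" and Hess: "Hess d f = l ^ k"
    and K: "\<And>x y. x \<in> K \<Longrightarrow> y \<in> K \<Longrightarrow> x + y \<in> K" "\<And>x. x \<in> K \<Longrightarrow> - x \<in> K"
      "\<And>x y. x \<in> K \<Longrightarrow> y \<in> K \<Longrightarrow> x * y \<in> K" "\<And>x. x \<in> K \<Longrightarrow> inverse x \<in> K"
      "\<And>c. to_fract (Const c) \<in> K" "\<And>i. i < d \<Longrightarrow> to_fract (pdiff i f) \<in> K"
    and ij: "i < d" "j < d"
  shows "to_fract (Var i * Var j) \<in> K"
proof (rule ccontr)
  let ?z = "Var i * Var j"
  assume z: "to_fract ?z \<notin> K"
  have "1 \<in> K" using K(5)[of 1] by simp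
  then obtain \<phi> where add: "\<And>x y. \<phi> (x + y) = \<phi> x + \<phi> y"
    and lin: "\<And>k x. k \<in> K \<Longrightarrow> \<phi> (k * x) = k * \<phi> x" and \<phi>: "\<phi> 1 = 0" "\<phi> (to_fract ?z) = 1"
    using subfield_separating_functional[OF _ K(1-4) z] by blast
  have right: "contract \<phi> (u * right_copy p) = contract (\<lambda>x. \<phi> (to_fract p * x)) u" for u p
    by (rule contract_mult_right) (use add lin K(5) in auto)
  define N where "N = {t. \<forall>u. contract \<phi> (u * t) = 0}"
  have diff: "left_copy (pdiff i f) - right_copy (pdiff i f) \<in> N" if "i < d" for i
  proof -
    have "contract (\<lambda>x. \<phi> (to_fract (pdiff i f) * x)) u = to_fract (pdiff i f) * contract \<phi> u" for u
      by (simp add: contract_def lin K(6) that sum_distrib_left mult_ac)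
    then show ?thesis
      by (simp add: N_def right_diff_distrib contract_diff contract_mult_left right)
  qed
  interpret L: comm_ring_hom left_copy unfolding left_copy_def by (intro eval_hom_hom outer_const_hom)
  interpret R: comm_ring_hom right_copy unfolding right_copy_def by (intro eval_hom_hom outer_const_hom)
  have N: "0 \<in> N" "\<And>x y. x \<in> N \<Longrightarrow> y \<in> N \<Longrightarrow> x + y \<in> N" "\<And>r x. x \<in> N \<Longrightarrow> r * x \<in> N"
    by (auto simp: N_def distrib_left contract_add simp flip: mult.assoc)
  have V: "left_copy (Var i) = Poly_Mapping.single 0 (to_fract (Var i))"
    "right_copy (Var i) = Poly_Mapping.single (Poly_Mapping.single i 1) 1" for i
    by (simp_all add: left_copy_def right_copy_def eval_hom_Var outer_const_hom)
  have "(2 * left_copy l) ^ (2 * k) * (2 * (left_copy (Var i) * left_copy (Var j)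
      - right_copy (Var i) * right_copy (Var j))) \<in> N"
    unfolding V unfolding left_copy_def
    by (rule polar_fibre[OF f outer_const_hom l(1) Hess N _ ij])
      (use diff in \<open>simp_all add: left_copy_def right_copy_def\<close>)
  also have "(2 * left_copy l) ^ (2 * k) * (2 * (left_copy (Var i) * left_copy (Var j)
      - right_copy (Var i) * right_copy (Var j)))
    = (left_copy ?z - right_copy ?z) * left_copy ((2 * l) ^ (2 * k) * 2)"
  proof -
    have "left_copy 2 = 2" using L.hom_add[of 1 1] by simp
    then show ?thesis by (simp add: L.hom_mult L.hom_power R.hom_mult mult_ac)
  qed
  finally have "contract \<phi> (1 * ((left_copy ?z - right_copy ?z) * left_copy ((2 * l) ^ (2 * k) * 2))) = 0"
    unfolding N_def by blast
  then have "to_fract ((2 * l) ^ (2 * k) * 2) * (contract \<phi> (1 * left_copy ?z) - contract \<phi> (1 * right_copy ?z)) = 0"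
    by (simp only: mult_1 contract_mult_left contract_diff)
  moreover have "contract \<psi> 1 = \<psi> 1" for \<psi>
    using contract_single[of \<psi> 0 1] by simp
  then have "contract \<phi> (1 * left_copy ?z) - contract \<phi> (1 * right_copy ?z) = - 1"
    unfolding contract_mult_left right using \<phi> by simp
  ultimately have "to_fract ((2 * l) ^ (2 * k) * 2) = 0"
    by (simp only: mult_minus_right mult_1_right neg_equal_0_iff_equal)
  moreover have "(2::cpoly) \<noteq> 0" by simp
  ultimately show False using l(2) by (simp del: to_fract_mult)
qed

section \<open>The inverse of the polar map\<close>

text \<open>Differentiating a relation \<open>P(g) = 0\<close> and inverting the Jacobian matrix gives the relations
  \<open>(\<partial>\<^sub>i P)(g) = 0\<close> of smaller degree. By induction all \<open>\<partial>\<^sub>i P\<close> vanish, and so does \<open>P\<close> by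
  Euler's identity.\<close>

lemma jacobian_criterion:
  assumes J: "det (mat d d (\<lambda>(i, j). pdiff i (g j))) \<noteq> 0"
    and P: "P \<in> forms d n" "subst g P = 0"
  shows "P = 0"
  using P
proof (induction n arbitrary: P)
  case 0
  then show ?case by (metis forms_0_Const subst_Const)
next
  case (Suc n)
  have "pdiff j P = 0" if "j < d" for j
  proof -
    have "det (mat d d (\<lambda>(i, j). pdiff i (g j))) * subst g (pdiff j P) \<in> {0}"
    proof (rule determinant_trick[of _ d])
      fix i assume "i < d"
      have "(\<Sum>j<d. pdiff i (g j) * subst g (pdiff j P)) = pdiff i (subst g P)"
        by (simp add: chain_rule[OF forms_polys[OF Suc.prems(1)]] mult.commute)
      then show "(\<Sum>j<d. mat d d (\<lambda>(i, j). pdiff i (g j)) $$ (i, j) * subst g (pdiff j P)) \<in> {0}"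
        using \<open>i < d\<close> Suc.prems(2) by simp
    qed (use that in auto)
    then have "subst g (pdiff j P) = 0" using J by simp
    then show ?thesis using Suc.IH[of "pdiff j P"] pdiff_forms[OF Suc.prems(1), of j] by simp
  qed
  then have "of_nat (Suc n) * P = 0" using Euler_identity[OF Suc.prems(1)] by simp
  then show ?case using of_nat_neq_0[where ?'a = cpoly, of n] by (metis mult_eq_0_iff)
qed

text \<open>The fractions \<open>P(F) / Q(F)\<close> form a subfield containing the constants and the components of the
  polar map.\<close>

lemma coordinate_products_rational:
  assumes f: "f \<in> forms d 3" and l: "l \<in> forms d 1" "l \<noteq> 0" and Hess: "Hess d f = l ^ k"
    and ij: "i < d" "j < d"
  shows "\<exists>P Q. P \<in> polys d \<and> Q \<in> polys d \<and> subst (\<lambda>i. pdiff i f) Q \<noteq> 0 \<and>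
    subst (\<lambda>i. pdiff i f) Q * (Var i * Var j) = subst (\<lambda>i. pdiff i f) P"
proof -
  define s where "s = subst (\<lambda>i. pdiff i f)"
  interpret s: comm_ring_hom s unfolding s_def by (rule subst_hom)
  define K where "K = {to_fract (s P) / to_fract (s Q) | P Q. P \<in> polys d \<and> Q \<in> polys d \<and> s Q \<noteq> 0}"
  have KI: "to_fract (s P) / to_fract (s Q) \<in> K" if "P \<in> polys d" "Q \<in> polys d" "s Q \<noteq> 0" for P Q
    using that by (auto simp: K_def)
  have KE: "\<exists>P Q. x = to_fract (s P) / to_fract (s Q) \<and> P \<in> polys d \<and> Q \<in> polys d \<and> s Q \<noteq> 0"
    if "x \<in> K" for x using that by (auto simp: K_def)
  have poly: "to_fract (s P) \<in> K" if "P \<in> polys d" for P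
    using KI[OF that one_polys] by simp
  have "to_fract (Var i * Var j) \<in> K"
  proof (rule coordinate_products_in_subfield[OF f l Hess _ _ _ _ _ _ ij])
    fix x y assume "x \<in> K" "y \<in> K"
    then obtain P Q P' Q' where x: "x = to_fract (s P) / to_fract (s Q)" "P \<in> polys d" "Q \<in> polys d" "s Q \<noteq> 0"
      and y: "y = to_fract (s P') / to_fract (s Q')" "P' \<in> polys d" "Q' \<in> polys d" "s Q' \<noteq> 0"
      using KE by metis
    have "x + y = to_fract (s (P * Q' + P' * Q)) / to_fract (s (Q * Q'))"
      using x y by (simp add: s.hom_add s.hom_mult add_frac_eq)
    then show "x + y \<in> K" using KI[of "P * Q' + P' * Q" "Q * Q'"] x y
      by (simp add: add_polys mult_polys s.hom_mult)
    have "x * y = to_fract (s (P * P')) / to_fract (s (Q * Q'))"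
      using x y by (simp add: s.hom_mult)
    then show "x * y \<in> K" using KI[of "P * P'" "Q * Q'"] x y
      by (simp add: mult_polys s.hom_mult)
  next
    fix x assume "x \<in> K"
    then obtain P Q where x: "x = to_fract (s P) / to_fract (s Q)" "P \<in> polys d" "Q \<in> polys d" "s Q \<noteq> 0"
      using KE by metis
    have "s (Const (- 1)) = - 1" by (simp only: s_def subst_Const) (simp add: Const_def single_uminus)
    then have "- x = to_fract (s (Const (- 1) * P)) / to_fract (s Q)"
      using x by (simp add: s.hom_mult)
    then show "- x \<in> K" using KI[of "Const (- 1) * P" Q] x by (simp add: mult_polys)
    show "inverse x \<in> K"
    proof (cases "s P = 0")
      case True
      then show ?thesis using x poly[of 0] by simp
    next
      case False
      then show ?thesis using KI[of Q P] x by simp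
    qed
  next
    show "to_fract (Const c) \<in> K" for c
      using poly[of "Const c"] by (simp add: s_def)
    show "to_fract (pdiff i f) \<in> K" if "i < d" for i
      using poly[OF Var_polys[OF that]] by (simp add: s_def)
  qed
  then obtain P Q where PQ: "to_fract (Var i * Var j) = to_fract (s P) / to_fract (s Q)"
    "P \<in> polys d" "Q \<in> polys d" "s Q \<noteq> 0" using KE by metis
  then have "to_fract (s Q * (Var i * Var j)) = to_fract (s P)" by (simp add: field_simps)
  then show ?thesis using PQ unfolding s_def to_fract_eq_iff by blast
qed

text \<open>Write the products \<open>x\<^sub>0 x\<^sub>i\<close> as fractions over a common denominator \<open>R(F)\<close>, and keep only one
  homogeneous component of \<open>R\<close> that does not vanish at \<open>F\<close>. The numerators then have to be replaced by
  their components of the next degree, since \<open>x\<^sub>0 x\<^sub>i\<close> and the components of \<open>F\<close> are quadratic.\<close>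

lemma polar_left_inverse:
  assumes f: "f \<in> forms d 3" and l: "l \<in> forms d 1" "l \<noteq> 0" and Hess: "Hess d f = l ^ k"
    and d: "0 < d"
  obtains G e q where "q \<noteq> 0" "\<And>i. i < d \<Longrightarrow> G i \<in> forms d (e + 1)"
    "\<And>i. i < d \<Longrightarrow> subst (\<lambda>i. pdiff i f) (G i) = q * (Var 0 * Var i)"
proof -
  define s where "s = subst (\<lambda>i. pdiff i f)"
  interpret s: comm_ring_hom s unfolding s_def by (rule subst_hom)
  have "\<forall>i. \<exists>P Q. i < d \<longrightarrow> P \<in> polys d \<and> Q \<in> polys d \<and> s Q \<noteq> 0 \<and> s Q * (Var 0 * Var i) = s P"
    using coordinate_products_rational[OF f l Hess d] unfolding s_def by blast
  then obtain P Q where PQ: "\<And>i. i < d \<Longrightarrow> P i \<in> polys d" "\<And>i. i < d \<Longrightarrow> Q i \<in> polys d"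
      "\<And>i. i < d \<Longrightarrow> s (Q i) \<noteq> 0" "\<And>i. i < d \<Longrightarrow> s (Q i) * (Var 0 * Var i) = s (P i)"
    by metis
  define R where "R = (\<Prod>i<d. Q i)"
  define S where "S i = P i * (\<Prod>j\<in>{..<d}-{i}. Q j)" for i
  have R: "R \<in> polys d" "s R \<noteq> 0"
    unfolding R_def by (auto intro!: prod_polys simp: PQ s.hom_prod)
  have S: "S i \<in> polys d" "s R * (Var 0 * Var i) = s (S i)" if "i < d" for i
  proof -
    show "S i \<in> polys d" unfolding S_def by (intro mult_polys prod_polys) (auto simp: PQ that)
    have "R = Q i * (\<Prod>j\<in>{..<d}-{i}. Q j)" unfolding R_def using that by (simp add: prod.remove)
    then show "s R * (Var 0 * Var i) = s (S i)"
      using PQ(4)[OF that] by (simp add: S_def s.hom_mult mult_ac flip: PQ(4)[OF that])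
  qed
  obtain e where e: "s (hom_comp e R) \<noteq> 0"
    using R(2) sum_hom_comp[of R] by (metis (no_types, lifting) s.hom_sum sum.neutral)
  show thesis
  proof (rule that[of "s (hom_comp e R)" "\<lambda>i. hom_comp (e + 1) (S i)" e])
    show "s (hom_comp e R) \<noteq> 0" by fact
    fix i assume i: "i < d"
    show "hom_comp (e + 1) (S i) \<in> forms d (e + 1)" using S(1)[OF i] by (rule hom_comp_forms)
    note F = cubic_polar_forms[OF f]
    have sR: "s R \<in> polys d" unfolding s_def by (intro subst_polys[OF R(1)] forms_polys[OF F])
    have "Var 0 * Var i \<in> forms d 2"
      using mult_forms[OF Var_forms[OF d] Var_forms[OF i]] by (simp add: numeral_2_eq_2)
    then have "hom_comp (2 * e + 2) (s (S i)) = hom_comp (2 * e) (s R) * (Var 0 * Var i)"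
      using hom_comp_mult_form[OF sR] S(2)[OF i] by metis
    moreover have "hom_comp (2 * (e + 1)) (s (S i)) = s (hom_comp (e + 1) (S i))"
      unfolding s_def by (rule hom_comp_subst[OF S(1)[OF i] F]) simp
    moreover have "hom_comp (2 * e) (s R) = s (hom_comp e R)"
      unfolding s_def by (rule hom_comp_subst[OF R(1) F]) simp
    ultimately show "subst (\<lambda>i. pdiff i f) (hom_comp (e + 1) (S i)) = s (hom_comp e R) * (Var 0 * Var i)"
      unfolding s_def by simp
  qed
qed

theorem homaloidal_if_Hess_power:
  assumes d: "0 < d" and f: "f \<in> forms d 3"
    and l: "l \<in> forms d 1" "l \<noteq> 0" and Hess: "Hess d f = l ^ k"
  shows "homaloidal d f"
proof -
  define F where "F i = pdiff i f" for i
  have F: "F i \<in> forms d 2" for i unfolding F_def by (rule cubic_polar_forms[OF f])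
  obtain G e q where q: "q \<noteq> 0" and G: "\<And>i. i < d \<Longrightarrow> G i \<in> forms d (e + 1)"
    and GF: "\<And>i. i < d \<Longrightarrow> subst F (G i) = q * (Var 0 * Var i)"
    using polar_left_inverse[OF f l Hess d] unfolding F_def[abs_def, symmetric] by metis
  have Hess0: "det (mat d d (\<lambda>(i, j). pdiff i (F j))) \<noteq> 0"
    using Hess l by (simp add: Hess_def F_def)
  interpret s: comm_ring_hom "subst F" by (rule subst_hom)
  have V0: "Var i \<noteq> 0" for i by (simp add: Var_def) (metis lookup_single_eq lookup_zero zero_neq_one)
  obtain i0 where i0: "i0 < d" "F i0 \<noteq> 0"
  proof (rule ccontr)
    assume "\<not> thesis"
    then have *: "\<And>i. i < d \<Longrightarrow> F i = 0" using that by blast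
    have "mat d d (\<lambda>(i, j). pdiff i (F j)) = 0\<^sub>m d d" by (intro eq_matI) (auto simp: *)
    then show False using Hess0 d by simp
  qed
  define r where "r = q * Var 0"
  have r: "r \<noteq> 0" using q V0 by (simp add: r_def)
  \<comment> \<open>At \<open>y = F(x)\<close> the composite \<open>F(G(y))\<close> is \<open>F\<close> at a multiple of \<open>x\<close>, a multiple of \<open>y\<close>.\<close>
  have FGF: "subst F (subst G (F i)) = r ^ 2 * F i" for i
  proof -
    have "subst F (subst G (F i)) = subst (\<lambda>j. r * Var j) (F i)"
      unfolding subst_subst by (rule subst_cong[OF forms_polys[OF F]]) (simp add: GF r_def mult_ac)
    also have "\<dots> = r ^ 2 * F i"
      using eval_hom_scale[OF F Const_hom, of r Var i] by (simp flip: subst_eq_eval_hom)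
    finally show ?thesis .
  qed
  have GF_forms: "subst F (G i) \<in> forms d (2 * (e + 1))" if "i < d" for i
    by (rule subst_forms[OF G[OF that] F])
  have FG_forms: "subst G (F i) \<in> forms d ((e + 1) * 2)" for i
    by (rule subst_forms[OF F G])
  have "subst G (F i) * Var j = subst G (F j) * Var i" if "i < d" "j < d" for i j
  proof -
    have "subst G (F i) * Var j - subst G (F j) * Var i \<in> forms d ((e + 1) * 2 + 1)"
      by (intro diff_forms mult_forms FG_forms Var_forms that)
    moreover have "subst F (subst G (F i) * Var j - subst G (F j) * Var i) = 0"
      by (simp add: s.hom_minus s.hom_mult FGF mult_ac)
    ultimately have "subst G (F i) * Var j - subst G (F j) * Var i = 0"
      by (rule jacobian_criterion[OF Hess0])
    then show ?thesis by simp
  qed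
  then have 1: "same_rational_map d (rat_comp F G) Var"
    by (simp add: same_rational_map_def rat_comp_def)
  have "subst G (F i0) \<noteq> 0" using FGF[of i0] r i0(2) by auto
  then have 2: "rational_map d (rat_comp F G)"
    unfolding rational_map_def rat_comp_def using FG_forms i0 by blast
  have 3: "same_rational_map d (rat_comp G F) Var"
    by (simp add: same_rational_map_def rat_comp_def GF mult_ac)
  have GF0: "subst F (G 0) \<noteq> 0" using q V0 d by (simp add: GF)
  then have 4: "rational_map d (rat_comp G F)"
    unfolding rational_map_def rat_comp_def using GF_forms d by blast
  have "G 0 \<noteq> 0" using GF0 by auto
  then have 5: "rational_map d G" unfolding rational_map_def using G d by blast
  have 6: "rational_map d F" unfolding rational_map_def using F i0 by blast
  show ?thesis
    using 1 2 3 4 5 6 unfolding homaloidal_def birational_map_def F_def[abs_def] by blast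
qed

section \<open>Persistent cubics\<close>

lemma id_hom: "comm_ring_hom (\<lambda>c. c :: complex)"
  by unfold_locales auto

lemma poly_const_hom: "comm_ring_hom (\<lambda>c. [:c:] :: complex poly)"
  by unfold_locales (auto simp: one_pCons)

abbreviation eval_at :: "(nat \<Rightarrow> complex) \<Rightarrow> cpoly \<Rightarrow> complex" where
  "eval_at \<equiv> eval_hom (\<lambda>c. c)"

definition on_line :: "(nat \<Rightarrow> complex) \<Rightarrow> (nat \<Rightarrow> complex) \<Rightarrow> cpoly \<Rightarrow> complex poly" where
  "on_line u v = eval_hom (\<lambda>c. [:c:]) (\<lambda>j. [:u j, v j:])"

lemmas on_line_simps = on_line_def eval_hom_Const[OF poly_const_hom] eval_hom_Var[OF poly_const_hom]
  eval_hom_add[OF poly_const_hom] eval_hom_mult[OF poly_const_hom]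

lemmas eval_simps = eval_hom_Const[OF id_hom] eval_hom_Var[OF id_hom]
  eval_hom_add[OF id_hom] eval_hom_mult[OF id_hom]

lemma poly_on_line: "poly (on_line u v p) t = eval_at (\<lambda>j. u j + t * v j) p"
  by (induction p rule: cpoly_induct) (simp_all add: on_line_simps eval_simps)

lemma pderiv_on_line:
  "pderiv (on_line u (\<lambda>j. if j = i then 1 else 0) p) = on_line u (\<lambda>j. if j = i then 1 else 0) (pdiff i p)"
  by (induction p rule: cpoly_induct)
    (simp_all add: on_line_simps pdiff_Var pderiv_pCons pdiff_add pdiff_mult pderiv_add pderiv_mult
      one_pCons algebra_simps eval_hom_Const[OF poly_const_hom, of _ 0, simplified]
      eval_hom_Const[OF poly_const_hom, of _ 1, simplified])

text \<open>The partial derivatives of \<open>p\<close> vanish everywhere, being derivatives of its restrictions to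
  lines. So they are zero by induction on the degree, and Euler's identity gives \<open>p = 0\<close>.\<close>

lemma form_eq_0_if_vanishes:
  assumes "p \<in> forms d n" "\<And>u. eval_at u p = 0"
  shows "p = 0"
  using assms
proof (induction n arbitrary: p)
  case 0
  then show ?case by (metis Const_0 eval_hom_Const forms_0_Const id_hom)
next
  case (Suc n)
  have "pdiff i p = 0" for i
  proof -
    have "eval_at u (pdiff i p) = 0" for u
    proof -
      let ?v = "\<lambda>j. if j = i then 1 else 0"
      have "on_line u ?v p = 0"
        using Suc.prems(2) by (simp add: poly_on_line flip: poly_all_0_iff_0)
      then have "on_line u ?v (pdiff i p) = 0" by (simp flip: pderiv_on_line)
      then have "poly (on_line u ?v (pdiff i p)) 0 = 0" by simp
      then show ?thesis by (simp add: poly_on_line)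
    qed
    then show ?thesis using Suc.IH[of "pdiff i p"] pdiff_forms[OF Suc.prems(1), of i] by simp
  qed
  then have "of_nat (Suc n) * p = 0" using Euler_identity[OF Suc.prems(1)] by simp
  then show ?case using of_nat_neq_0[where ?'a = cpoly, of n] by (metis mult_eq_0_iff)
qed

lemma form_constant_on_line:
  assumes "\<And>t. eval_at (\<lambda>j. u j + t * v j) p \<noteq> 0"
  shows "eval_at (\<lambda>j. u j + t * v j) p = eval_at u p"
proof -
  have "constant (poly (on_line u v p))"
    using fundamental_theorem_of_algebra[of "on_line u v p"] assms by (auto simp: poly_on_line)
  then have "poly (on_line u v p) t = poly (on_line u v p) 0"
    unfolding constant_def by blast
  then show ?thesis by (simp add: poly_on_line)
qed

lemma lookup_pdiff:
  "Poly_Mapping.lookup (pdiff i p) m =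
     of_nat (Poly_Mapping.lookup m i + 1) * Poly_Mapping.lookup p (m + Poly_Mapping.single i 1)"
proof (induction p rule: poly_mapping_term_induct)
  case (single n c)
  let ?e = "Poly_Mapping.single i (1::nat)"
  show ?case
  proof (cases "n = m + ?e")
    case True
    then show ?thesis by (simp add: pdiff_single lookup_add)
  next
    case False
    have "n = (n - ?e) + ?e" if "Poly_Mapping.lookup n i \<noteq> 0"
      using that by (intro poly_mapping_eqI) (auto simp: lookup_add lookup_minus lookup_single when_def)
    then have "Poly_Mapping.lookup n i = 0 \<or> n - ?e \<noteq> m" using False by metis
    then show ?thesis using False by (auto simp: pdiff_single lookup_single when_def)
  qed
qed (simp_all add: pdiff_add lookup_add distrib_left)

text \<open>The coefficient of a square is doubled by differentiation while a mixed coefficient is not. This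
  matches the two cases in the definition of the Gram matrix, which is half the Hessian matrix.\<close>

lemma gram_mat_eq:
  "gram_mat d q = mat d d (\<lambda>(i, j). Poly_Mapping.lookup (pdiff i (pdiff j q)) 0 / 2)"
  by (intro eq_matI) (auto simp: gram_mat_def lookup_pdiff lookup_single when_def)

text \<open>Third derivatives of a cubic are constant, so the Hessian matrix of \<open>dir_deriv d u f\<close> is the
  Hessian matrix of \<open>f\<close> evaluated at \<open>u\<close>.\<close>

lemma lookup_third_derivative_dir_deriv:
  assumes f: "f \<in> forms d 3"
  shows "Poly_Mapping.lookup (pdiff i (pdiff j (dir_deriv d u f))) 0
    = eval_at (\<lambda>k. u $ k) (pdiff i (pdiff j f))"
proof -
  have sum: "pdiff i (sum s A) = (\<Sum>x\<in>A. pdiff i (s x))" for i A and s :: "nat \<Rightarrow> cpoly"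
    by (induction A rule: infinite_finite_induct) (auto simp: pdiff_add)
  have C: "pdiff i (Const c * p) = Const c * pdiff i p" for i c p
    by (simp add: pdiff_mult)
  have third: "pdiff i (pdiff j (pdiff k f)) = Const (Poly_Mapping.lookup (pdiff i (pdiff j (pdiff k f))) 0)" for k
    using pdiff_forms[OF cubic_hess_forms[OF f], of i j k] by (intro forms_0_Const[of _ d]) simp
  have "Poly_Mapping.lookup (pdiff i (pdiff j (dir_deriv d u f))) 0
    = (\<Sum>k<d. Poly_Mapping.lookup (Const (u $ k) * pdiff i (pdiff j (pdiff k f))) 0)"
    by (simp add: dir_deriv_def sum C lookup_sum)
  also have "\<dots> = (\<Sum>k<d. Poly_Mapping.lookup (pdiff k (pdiff i (pdiff j f))) 0 * u $ k)"
  proof (intro sum.cong refl)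
    fix k
    have scale: "Poly_Mapping.lookup (Const a * Const b) 0 = a * b" for a b
      by (simp add: Const_def mult_single)
    have "pdiff i (pdiff j (pdiff k f)) = pdiff k (pdiff i (pdiff j f))"
      unfolding pdiff_commute[of j k f] by (rule pdiff_commute)
    then show "Poly_Mapping.lookup (Const (u $ k) * pdiff i (pdiff j (pdiff k f))) 0
      = Poly_Mapping.lookup (pdiff k (pdiff i (pdiff j f))) 0 * u $ k"
      using scale[of "u $ k"] third[of k] by (metis mult.commute)
  qed
  also have "\<dots> = eval_at (\<lambda>k. u $ k) (pdiff i (pdiff j f))"
    by (simp add: eval_linear_form[OF cubic_hess_forms[OF f] id_hom])
  finally show ?thesis .
qed

lemma eval_Hess_nonzero_if_maximal_rank:
  assumes f: "f \<in> forms d 3" and "maximal_rank d (dir_deriv d u f)"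
  shows "eval_at (\<lambda>k. u $ k) (Hess d f) \<noteq> 0"
proof -
  let ?G = "gram_mat d (dir_deriv d u f)"
  let ?M = "mat d d (\<lambda>(i, j). eval_at (\<lambda>k. u $ k) (pdiff i (pdiff j f)))"
  have "?G \<in> carrier_mat d d" by (simp add: gram_mat_def)
  then have "det ?G \<noteq> 0"
    using assms(2) vec_space.det_rank_iff[of ?G d] by (simp add: maximal_rank_def)
  moreover have "?G = (1 / 2) \<cdot>\<^sub>m ?M"
    by (intro eq_matI) (auto simp: gram_mat_eq lookup_third_derivative_dir_deriv[OF f])
  ultimately have "det ?M \<noteq> 0" by simp
  then show ?thesis by (simp add: eval_Hess[OF id_hom])
qed

lemma Hess_forms:
  assumes f: "f \<in> forms d 3"
  shows "Hess d f \<in> forms d d"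
proof -
  let ?M = "mat d d (\<lambda>(i, j). pdiff i (pdiff j f))"
  have "signof p * (\<Prod>i = 0..<d. ?M $$ (i, p i)) \<in> forms d d" if p: "p permutes {0..<d}" for p
  proof -
    have entry: "?M $$ (i, p i) \<in> forms d 1" if "i \<in> {0..<d}" for i
    proof -
      have "p i < d" using permutes_in_image[OF p, of i] that by simp
      then show ?thesis using that cubic_hess_forms[OF f] by simp
    qed
    have "(\<Prod>i = 0..<d. ?M $$ (i, p i)) \<in> forms d (\<Sum>i = 0..<d. 1)"
      by (rule prod_forms[OF _ entry]) auto
    then have *: "(\<Prod>i = 0..<d. ?M $$ (i, p i)) \<in> forms d d" by simp
    then show ?thesis using uminus_forms[OF *] by (auto simp: sign_def)
  qed
  then show ?thesis
    unfolding Hess_def by (subst det_def'[of _ d]) auto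
qed

lemma hyperplane_closed:
  assumes "hyperplane d S"
  shows "S \<subseteq> carrier_vec d" "0\<^sub>v d \<in> S" "\<And>u v. u \<in> S \<Longrightarrow> v \<in> S \<Longrightarrow> u + v \<in> S"
    "\<And>c u. u \<in> S \<Longrightarrow> c \<cdot>\<^sub>v u \<in> S"
  using assms unfolding hyperplane_def VectorSpace.subspace_def submodule_def
  by (auto simp: module_vec_simps class_ring_simps)

text \<open>A basis \<open>B\<close> of \<open>S\<close> together with any \<open>e\<close> outside \<open>S\<close> has as many elements as the dimension,
  hence is a basis of the whole space. The functional \<open>ht\<close>, the \<open>e\<close>-coordinate along \<open>S\<close>, is the
  linear form that defines \<open>S\<close>.\<close>

lemma hyperplane_functional:
  assumes S: "hyperplane d S"
  shows "\<exists>e ht. e \<in> carrier_vec d \<and> e \<notin> S \<and> ht e = 1 \<and>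
    (\<forall>u \<in> carrier_vec d. u - ht u \<cdot>\<^sub>v e \<in> S) \<and>
    (\<forall>u \<in> carrier_vec d. \<forall>v \<in> carrier_vec d. ht (u + v) = ht u + ht v) \<and>
    (\<forall>u \<in> carrier_vec d. \<forall>c. ht (c \<cdot>\<^sub>v u) = c * ht u)"
proof -
  interpret vec_space "TYPE(complex)" d .
  note SV = hyperplane_closed(1)[OF S] and add = hyperplane_closed(3)[OF S]
    and smult = hyperplane_closed(4)[OF S]
  have sub: "submodule class_ring S V" and dimS: "vectorspace.dim class_ring (vs S) + 1 = d"
    using S by (auto simp: hyperplane_def VectorSpace.subspace_def)
  have "\<exists>B. finite B \<and> maximal B (\<lambda>T. T \<subseteq> S \<and> lin_indpt T)"
  proof (rule maximal_exists)
    show "finite A \<and> card A \<le> dim" if "A \<subseteq> S \<and> lin_indpt A" for A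
      using that SV li_le_dim[OF fin_dim, of A] by auto
    show "{} \<subseteq> S \<and> lin_indpt {}" by (auto simp: lin_dep_def)
  qed
  then obtain B where B: "finite B" "B \<subseteq> S" "lin_indpt B"
    and max: "\<And>T. T \<supseteq> B \<Longrightarrow> T \<subseteq> S \<Longrightarrow> lin_indpt T \<Longrightarrow> T = B"
    by (auto simp: maximal_def)
  have BV: "B \<subseteq> carrier_vec d" using B SV by auto
  have "span B \<subseteq> S" by (rule span_is_subset[OF B(2) sub])
  moreover have "x \<in> span B" if x: "x \<in> S" for x
  proof (rule ccontr)
    assume nx: "x \<notin> span B"
    then have "x \<notin> B" using in_own_span[of B] BV by auto
    then have "lin_indpt (B \<union> {x})" using lin_dep_iff_in_span[of B x] nx B BV x SV by auto
    then show False using max[of "B \<union> {x}"] B x \<open>x \<notin> B\<close> by auto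
  qed
  ultimately have spanB: "span B = S" by blast
  have "vectorspace.dim class_ring (vs (span B)) = card B"
    by (rule dim_span) (use B BV in \<open>auto simp: maximal_def\<close>)
  then have cardB: "card B + 1 = d" using dimS spanB by simp
  have "S \<noteq> carrier_vec d"
  proof
    assume "S = carrier_vec d"
    then have "basis B" using spanB B BV by (auto simp: basis_def)
    then show False using dim_basis[OF B(1)] cardB dim_is_n by simp
  qed
  then obtain e where e: "e \<in> carrier_vec d" "e \<notin> S" using SV by blast
  have eB: "e \<notin> B" using e B by auto
  have "lin_indpt (B \<union> {e})" using lin_dep_iff_in_span[of B e] e eB B BV spanB by auto
  then have "basis (B \<union> {e})"
    using B BV e cardB eB dim_is_n by (intro dim_li_is_basis) auto
  then have span: "span (insert e B) = carrier_vec d" by (simp add: basis_def)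
  have ex: "\<exists>k. u - k \<cdot>\<^sub>v e \<in> S" if u: "u \<in> carrier_vec d" for u
  proof -
    obtain a where "u = lincomb a (insert e B)"
      using u span finite_in_span[of "insert e B" u] B BV e by auto
    moreover have "lincomb a (insert e B) = a e \<cdot>\<^sub>v e + lincomb a B"
      using lincomb_insert2[where S=B and v=e and a=a] B BV e eB by (auto simp: module_vec_simps)
    moreover have l: "lincomb a B \<in> S" using spanB B in_spanI[of _ a B] by auto
    moreover have "a e \<cdot>\<^sub>v e + lincomb a B - a e \<cdot>\<^sub>v e = lincomb a B"
      using e l SV by (intro eq_vecI) auto
    ultimately have "u - a e \<cdot>\<^sub>v e \<in> S" by simp
    then show ?thesis by blast
  qed
  have unique: "k = k'" if k: "u - k \<cdot>\<^sub>v e \<in> S" "u - k' \<cdot>\<^sub>v e \<in> S" and u: "u \<in> carrier_vec d" for k k' u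
  proof (rule ccontr)
    assume "k \<noteq> k'"
    have "(1 / (k' - k)) \<cdot>\<^sub>v ((u - k \<cdot>\<^sub>v e) + (- 1) \<cdot>\<^sub>v (u - k' \<cdot>\<^sub>v e)) \<in> S"
      by (intro smult add k)
    moreover have "(1 / (k' - k)) \<cdot>\<^sub>v ((u - k \<cdot>\<^sub>v e) + (- 1) \<cdot>\<^sub>v (u - k' \<cdot>\<^sub>v e)) = e"
      using \<open>k \<noteq> k'\<close> u e by (intro eq_vecI) (auto simp: field_simps)
    ultimately show False using e by simp
  qed
  define ht where "ht u = (SOME k. u - k \<cdot>\<^sub>v e \<in> S)" for u
  have ht: "u - ht u \<cdot>\<^sub>v e \<in> S" if "u \<in> carrier_vec d" for u
    using someI_ex[OF ex[OF that]] unfolding ht_def .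
  have eqI: "ht u = k" if "u \<in> carrier_vec d" "u - k \<cdot>\<^sub>v e \<in> S" for u k
    using unique ht that by blast
  show ?thesis
  proof (intro exI[of _ e] exI[of _ ht] conjI ballI allI e ht)
    have "e - 1 \<cdot>\<^sub>v e = 0\<^sub>v d" using e by auto
    then show "ht e = 1" using e hyperplane_closed(2)[OF S] by (intro eqI) auto
  next
    fix u :: "complex vec" and c assume u: "u \<in> carrier_vec d"
    have "c \<cdot>\<^sub>v u - (c * ht u) \<cdot>\<^sub>v e = c \<cdot>\<^sub>v (u - ht u \<cdot>\<^sub>v e)"
      using u e by (intro eq_vecI) (auto simp: algebra_simps)
    then show "ht (c \<cdot>\<^sub>v u) = c * ht u" using u smult[OF ht[OF u]] by (intro eqI) auto
  next
    fix u v :: "complex vec" assume u: "u \<in> carrier_vec d" and v: "v \<in> carrier_vec d"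
    have "(u + v) - (ht u + ht v) \<cdot>\<^sub>v e = (u - ht u \<cdot>\<^sub>v e) + (v - ht v \<cdot>\<^sub>v e)"
      using u v e by (intro eq_vecI) (auto simp: algebra_simps)
    then show "ht (u + v) = ht u + ht v" using u v add[OF ht[OF u] ht[OF v]] by (intro eqI) auto
  qed
qed

lemma eval_cong:
  assumes "p \<in> polys d" "\<And>i. i < d \<Longrightarrow> u i = v i"
  shows "eval_at u p = eval_at v p"
  using assms(1)
  by (induction p rule: polys_induct) (simp_all add: assms eval_simps)

text \<open>Let \<open>L\<close> be the linear form that defines \<open>S\<close>, normalised by \<open>L(e) = 1\<close>. A point \<open>v\<close> with \<open>L(v) \<noteq> 0\<close>
  lies on the line through \<open>L(v) e\<close> in a direction of \<open>S\<close>. The Hessian does not vanish on this line,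
  so it takes the same value at \<open>v\<close> and at \<open>L(v) e\<close>.\<close>

lemma persistent_Hess_power:
  assumes d: "0 < d" and f: "f \<in> forms d 3" and "persistent_cubic d f"
  obtains l where "l \<in> forms d 1" "l \<noteq> 0" "Hess d f = l ^ d"
proof -
  obtain S where S: "hyperplane d S"
    and rank: "\<And>u. u \<in> carrier_vec d - S \<Longrightarrow> maximal_rank d (dir_deriv d u f)"
    using assms(3) by (auto simp: persistent_cubic_def)
  define ev where "ev u = eval_at (\<lambda>k. u $ k) (Hess d f)" for u :: "complex vec"
  have nz: "ev u \<noteq> 0" if "u \<in> carrier_vec d" "u \<notin> S" for u
    using eval_Hess_nonzero_if_maximal_rank[OF f rank] that by (simp add: ev_def)
  obtain e ht where e: "e \<in> carrier_vec d" "e \<notin> S"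
    and ht: "\<And>u. u \<in> carrier_vec d \<Longrightarrow> u - ht u \<cdot>\<^sub>v e \<in> S" and hte: "ht e = 1"
    and ht_add: "\<And>u v. u \<in> carrier_vec d \<Longrightarrow> v \<in> carrier_vec d \<Longrightarrow> ht (u + v) = ht u + ht v"
    and ht_smult: "\<And>c u. u \<in> carrier_vec d \<Longrightarrow> ht (c \<cdot>\<^sub>v u) = c * ht u"
    using hyperplane_functional[OF S] by blast
  note SV = hyperplane_closed(1)[OF S] and add = hyperplane_closed(3)[OF S]
    and smult = hyperplane_closed(4)[OF S]
  define L where "L = (\<Sum>i<d. Const (ht (unit_vec d i)) * Var i)"
  have L: "L \<in> forms d 1" unfolding L_def by (intro sum_forms Const_mult_forms Var_forms) auto
  have evalL: "eval_at u L = ht (vec d u)" for u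
  proof -
    have "ht (vec d (\<lambda>i. if i < n then u i else 0)) = (\<Sum>i<n. u i * ht (unit_vec d i))" if "n \<le> d" for n
      using that
    proof (induction n)
      case 0
      have "vec d (\<lambda>i. 0) = 0 \<cdot>\<^sub>v e" using e by (intro eq_vecI) auto
      then show ?case using ht_smult[OF e(1), of 0] by simp
    next
      case (Suc n)
      have "vec d (\<lambda>i. if i < Suc n then u i else 0)
        = vec d (\<lambda>i. if i < n then u i else 0) + u n \<cdot>\<^sub>v unit_vec d n"
        using Suc.prems by (intro eq_vecI) (auto simp: less_Suc_eq)
      then show ?case using Suc by (simp add: ht_add ht_smult)
    qed
    from this[of d] have "ht (vec d (\<lambda>i. if i < d then u i else 0)) = (\<Sum>i<d. u i * ht (unit_vec d i))"
      by simp
    moreover have "vec d (\<lambda>i. if i < d then u i else 0) = vec d u" by (intro eq_vecI) auto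
    moreover have "eval_at u L = (\<Sum>i<d. ht (unit_vec d i) * u i)"
    proof -
      interpret comm_ring_hom "eval_at u" by (rule eval_hom_hom[OF id_hom])
      show ?thesis unfolding L_def by (simp add: hom_sum eval_simps)
    qed
    ultimately show ?thesis by (simp add: mult.commute)
  qed
  have off: "ev v = ht v ^ d * ev e" if v: "v \<in> carrier_vec d" and m: "ht v \<noteq> 0" for v
  proof -
    define w where "w = v - ht v \<cdot>\<^sub>v e"
    have w: "w \<in> S" "w \<in> carrier_vec d" using ht[OF v] SV by (auto simp: w_def)
    have ev_line: "ev (ht v \<cdot>\<^sub>v e + t \<cdot>\<^sub>v w) = eval_at (\<lambda>k. ht v * e $ k + t * w $ k) (Hess d f)" for t
      unfolding ev_def by (rule eval_cong[OF forms_polys[OF Hess_forms[OF f]]]) (use e w in auto)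
    have "ht v \<cdot>\<^sub>v e + t \<cdot>\<^sub>v w \<notin> S" for t
    proof
      assume "ht v \<cdot>\<^sub>v e + t \<cdot>\<^sub>v w \<in> S"
      then have "(1 / ht v) \<cdot>\<^sub>v ((ht v \<cdot>\<^sub>v e + t \<cdot>\<^sub>v w) + (- t) \<cdot>\<^sub>v w) \<in> S"
        by (rule smult[OF add[OF _ smult[OF w(1)]]])
      moreover have "(1 / ht v) \<cdot>\<^sub>v ((ht v \<cdot>\<^sub>v e + t \<cdot>\<^sub>v w) + (- t) \<cdot>\<^sub>v w) = e"
        using e w m by (intro eq_vecI) (auto simp: field_simps)
      ultimately show False using e by simp
    qed
    then have "eval_at (\<lambda>k. ht v * e $ k + t * w $ k) (Hess d f) \<noteq> 0" for t
      unfolding ev_line[symmetric] using e w by (intro nz) auto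
    then have "ev (ht v \<cdot>\<^sub>v e + 1 \<cdot>\<^sub>v w) = eval_at (\<lambda>k. ht v * e $ k) (Hess d f)"
      unfolding ev_line by (rule form_constant_on_line)
    moreover have "ht v \<cdot>\<^sub>v e + 1 \<cdot>\<^sub>v w = v" using e v by (intro eq_vecI) (auto simp: w_def)
    ultimately show ?thesis
      by (simp add: eval_hom_scale[OF Hess_forms[OF f] id_hom] ev_def)
  qed
  have Hess: "Hess d f = Const (ev e) * L ^ d"
  proof -
    \<comment> \<open>The values are known only where \<open>L\<close> does not vanish, hence the factor \<open>L\<close> below.\<close>
    let ?D = "Hess d f - Const (ev e) * L ^ d"
    have "L * ?D \<in> forms d (1 + d)"
      using power_forms[OF L, of d] by (intro mult_forms L diff_forms Const_mult_forms Hess_forms f) simp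
    moreover have "eval_at u (L * ?D) = 0" for u
    proof -
      interpret comm_ring_hom "eval_at u" by (rule eval_hom_hom[OF id_hom])
      have "ev (vec d u) = eval_at u (Hess d f)"
        unfolding ev_def by (rule eval_cong[OF forms_polys[OF Hess_forms[OF f]]]) simp
      then show ?thesis using off[of "vec d u"]
        by (cases "ht (vec d u) = 0")
          (simp_all add: hom_mult hom_minus hom_power evalL eval_simps mult.commute)
    qed
    ultimately have "L * ?D = 0" by (rule form_eq_0_if_vanishes)
    moreover have "L \<noteq> 0"
    proof
      assume "L = 0"
      moreover have "vec d (\<lambda>k. e $ k) = e" using e by (intro eq_vecI) auto
      ultimately show False using evalL[of "\<lambda>k. e $ k"] hte by simp
    qed
    ultimately show ?thesis by simp
  qed
  have c: "ev e \<noteq> 0" using nz e by simp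
  have "{z. z ^ d = ev e} \<noteq> {}" using card_nth_roots[OF c d] d by (metis card.empty less_irrefl)
  then obtain b where b: "b ^ d = ev e" by blast
  interpret C: comm_ring_hom Const by (rule Const_hom)
  have eq: "Hess d f = (Const b * L) ^ d"
    by (simp add: Hess power_mult_distrib flip: b C.hom_power)
  show thesis
  proof (rule that[OF _ _ eq])
    show "Const b * L \<in> forms d 1" using L by blast
    have "Hess d f \<noteq> 0" using nz[OF e] by (auto simp: ev_def)
    then show "Const b * L \<noteq> 0" using eq d by auto
  qed
qed

theorem theorem31:
  fixes d :: nat and f :: cpoly
  assumes "d \<ge> 2" and "f \<in> forms d 3"
  shows "((\<exists>l \<in> forms d 1. \<exists>k::nat. l \<noteq> 0 \<and> Hess d f = l ^ k) \<longrightarrow> homaloidal d f) \<and>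
    (persistent_cubic d f \<longrightarrow> homaloidal d f)"
proof (intro conjI impI)
  have d: "0 < d" using assms(1) by simp
  note main = homaloidal_if_Hess_power[OF d assms(2)]
  show "homaloidal d f" if "\<exists>l \<in> forms d 1. \<exists>k::nat. l \<noteq> 0 \<and> Hess d f = l ^ k"
    using that main by blast
  show "homaloidal d f" if "persistent_cubic d f"
    using persistent_Hess_power[OF d assms(2) that] main by metis
qed

end
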